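(* Let $\Omega\subset\mathbb{R}^N$ ($N\ge2$) be a bounded Lipschitz domain and let $A$ be an N-function satisfying $(\Delta_2)$. Then there exists a constant $C_{\rm tr}=C_{\rm tr}(\Omega,A)>0$ such that $$\int_{\partial\Omega}A(|v|_{\partial\Omega}|)\,d\mathscr{H}^{N-1}\le C_{\rm tr}\left\{\int_\Omega A(|Dv|)\,dx+\int_\Omega A(|v|)\,dx\right\}\quad\text{for all }v\in W^{1,A}(\Omega;\mathbb{R}^N),$$ where $v|_{\partial\Omega}$ denotes the trace of $v$.
   Context: An N-function is a convex function $A:[0,\infty)\to[0,\infty)$ with $A(0)=0$, $A(s)>0$ for $s>0$, $\lim_{s\to0^+}A(s)/s=0$ and $\lim_{s\to\infty}A(s)/s=\infty$. Condition $(\Delta_2)$: there is $\kappa_A>0$ with $A(2s)\le\kappa_AA(s)$ for all $s\ge0$. $L^A(\Omega)$ is the space of measurable $v$ with $\int_\Omega A(|v|/s)\,dx<\infty$ for some $s>0$; $W^{1,A}(\Omega;\mathbb{R}^N)$ is the space of $v$ with $|v|\in L^A(\Omega)$ whose weak gradient satisfies $|Dv|\in L^A(\Omega)$; it is contained in $W^{1,1}(\Omega;\mathbb{R}^N)$, so traces are defined. *)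

theory Defs
  imports "HOL-Analysis.Analysis"
begin

definition N_function :: "(real \<Rightarrow> real) \<Rightarrow> bool" where
  "N_function A \<longleftrightarrow>
     convex_on {0..} A \<and> A 0 = 0 \<and> (\<forall>s>0. A s > 0) \<and>
     ((\<lambda>s. A s / s) \<longlongrightarrow> 0) (at_right 0) \<and>
     filterlim (\<lambda>s. A s / s) at_top at_top"

definition Delta2 :: "(real \<Rightarrow> real) \<Rightarrow> bool" where
  "Delta2 A \<longleftrightarrow> (\<exists>\<kappa>>0. \<forall>s\<ge>0. A (2 * s) \<le> \<kappa> * A s)"

text \<open>
  In a ball around each boundary point, the set lies strictly above the graph of a Lipschitz
  function. The unit vector \<open>e\<close> is the vertical direction of the local coordinates, and the
  hyperplane orthogonal to \<open>e\<close> plays the role of the horizontal space of dimension $N-1$.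
\<close>
definition bounded_lipschitz_domain :: "(real^'n) set \<Rightarrow> bool" where
  "bounded_lipschitz_domain \<Omega> \<longleftrightarrow>
     open \<Omega> \<and> connected \<Omega> \<and> \<Omega> \<noteq> {} \<and> bounded \<Omega> \<and>
     (\<forall>x\<in>frontier \<Omega>. \<exists>r>0. \<exists>e \<gamma> L. norm e = 1 \<and>
        L-lipschitz_on {z. z \<bullet> e = 0} \<gamma> \<and>
        \<Omega> \<inter> ball x r = {y \<in> ball x r. y \<bullet> e > \<gamma> (y - (y \<bullet> e) *\<^sub>R e)})"

text \<open>
  Hausdorff measure with the usual normalisation, so that in dimension \<open>d\<close> it agrees with
  Lebesgue measure. Boundedness of the covering sets is explicit because \<open>diameter\<close> is
  unspecified on unbounded sets; empty covering sets cost nothing, also for \<open>d = 0\<close>.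
\<close>
definition hausdorff_delta :: "nat \<Rightarrow> real \<Rightarrow> 'a::metric_space set \<Rightarrow> ennreal" where
  "hausdorff_delta d \<delta> E =
     (INF C \<in> {C :: nat \<Rightarrow> 'a set. (\<forall>i. bounded (C i) \<and> diameter (C i) \<le> \<delta>) \<and> E \<subseteq> (\<Union>i. C i)}.
        \<Sum>i. if C i = {} then 0 else ennreal (unit_ball_vol (real d) * (diameter (C i) / 2) ^ d))"

definition hausdorff_outer :: "nat \<Rightarrow> 'a::metric_space set \<Rightarrow> ennreal" where
  "hausdorff_outer d E = (SUP \<delta>\<in>{0<..}. hausdorff_delta d \<delta> E)"

text \<open>The sigma-algebra consists of all Caratheodory-measurable sets; it contains the Borel sets.\<close>
definition hausdorff_measure :: "nat \<Rightarrow> 'a::metric_space measure" where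
  "hausdorff_measure d =
     measure_of UNIV (lambda_system UNIV UNIV (hausdorff_outer d)) (hausdorff_outer d)"

definition boundary_measure :: "(real^'n) set \<Rightarrow> (real^'n) measure" where
  "boundary_measure \<Omega> = restrict_space (hausdorff_measure (CARD('n) - 1)) (frontier \<Omega>)"

fun C_k :: "nat \<Rightarrow> (real^'n \<Rightarrow> real) \<Rightarrow> bool" where
  "C_k 0 f \<longleftrightarrow> continuous_on UNIV f"
| "C_k (Suc k) f \<longleftrightarrow> (\<forall>x. f differentiable (at x)) \<and>
     (\<forall>i. C_k k (\<lambda>x. frechet_derivative f (at x) (axis i 1)))"

definition smooth :: "(real^'n \<Rightarrow> real) \<Rightarrow> bool" where
  "smooth f \<longleftrightarrow> (\<forall>k. C_k k f)"

definition test_function :: "(real^'n) set \<Rightarrow> (real^'n \<Rightarrow> real) \<Rightarrow> bool" where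
  "test_function \<Omega> \<phi> \<longleftrightarrow>
     smooth \<phi> \<and> compact (closure {x. \<phi> x \<noteq> 0}) \<and> closure {x. \<phi> x \<noteq> 0} \<subseteq> \<Omega>"

definition locally_integrable :: "(real^'n) set \<Rightarrow> (real^'n \<Rightarrow> 'b::euclidean_space) \<Rightarrow> bool" where
  "locally_integrable \<Omega> f \<longleftrightarrow> (\<forall>K. compact K \<and> K \<subseteq> \<Omega> \<longrightarrow> integrable (lebesgue_on K) f)"

text \<open>
  The entry \<open>G x $ i $ j\<close> is the weak derivative of the \<open>i\<close>-th component of \<open>v\<close> in the
  \<open>j\<close>-th coordinate direction, as in the library's \<open>jacobian\<close>.
\<close>
definition has_weak_gradient ::
    "(real^'n) set \<Rightarrow> (real^'n \<Rightarrow> real^'m) \<Rightarrow> (real^'n \<Rightarrow> real^'n^'m) \<Rightarrow> bool" where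
  "has_weak_gradient \<Omega> v G \<longleftrightarrow>
     locally_integrable \<Omega> v \<and> locally_integrable \<Omega> G \<and>
     (\<forall>\<phi> i j. test_function \<Omega> \<phi> \<longrightarrow>
        (LINT x|lebesgue_on \<Omega>. v x $ i * frechet_derivative \<phi> (at x) (axis j 1)) =
        - (LINT x|lebesgue_on \<Omega>. G x $ i $ j * \<phi> x))"

text \<open>The weak gradient is unique up to null sets; this is a chosen representative.\<close>
definition weak_gradient ::
    "(real^'n) set \<Rightarrow> (real^'n \<Rightarrow> real^'m) \<Rightarrow> real^'n \<Rightarrow> real^'n^'m" where
  "weak_gradient \<Omega> v = (SOME G. has_weak_gradient \<Omega> v G)"

definition orlicz_space :: "(real \<Rightarrow> real) \<Rightarrow> (real^'n) set \<Rightarrow> (real^'n \<Rightarrow> real) set" where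
  "orlicz_space A \<Omega> = {u \<in> borel_measurable (lebesgue_on \<Omega>).
     \<exists>s>0. (\<integral>\<^sup>+ x. ennreal (A (\<bar>u x\<bar> / s)) \<partial>lebesgue_on \<Omega>) < \<infinity>}"

text \<open>
  The norm on \<open>real^'n^'m\<close> is the Euclidean (Frobenius) norm of the matrix of derivatives.
\<close>
definition orlicz_sobolev_space ::
    "(real \<Rightarrow> real) \<Rightarrow> (real^'n) set \<Rightarrow> (real^'n \<Rightarrow> real^'m) set" where
  "orlicz_sobolev_space A \<Omega> = {v.
     (\<exists>G. has_weak_gradient \<Omega> v G) \<and>
     (\<lambda>x. norm (v x)) \<in> orlicz_space A \<Omega> \<and>
     (\<lambda>x. norm (weak_gradient \<Omega> v x)) \<in> orlicz_space A \<Omega>}"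

text \<open>
  \<open>T\<close> represents the trace of \<open>v\<close> in $W^{1,1}(\Omega)$, i.e. the value at \<open>v\<close> of the continuous
  extension to $W^{1,1}(\Omega)$ of the map sending a function smooth up to the boundary to its
  boundary values in $L^1(\partial\Omega)$: it is the $L^1(\partial\Omega)$-limit of the boundary
  values of smooth functions that converge to \<open>v\<close> in $W^{1,1}(\Omega)$. On a bounded Lipschitz
  domain every \<open>v\<close> in $W^{1,1}(\Omega)$ has a trace, unique up to null sets of the boundary
  measure.
\<close>
definition has_trace ::
    "(real^'n) set \<Rightarrow> (real^'n \<Rightarrow> real^'m) \<Rightarrow> (real^'n \<Rightarrow> real^'m) \<Rightarrow> bool" where
  "has_trace \<Omega> v T \<longleftrightarrow>
     integrable (boundary_measure \<Omega>) T \<and>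
     (\<exists>\<phi> :: nat \<Rightarrow> real^'n \<Rightarrow> real^'m.
        (\<forall>k i. smooth (\<lambda>x. \<phi> k x $ i)) \<and>
        (\<lambda>k. \<integral>\<^sup>+ x. ennreal (norm (\<phi> k x - v x)) \<partial>lebesgue_on \<Omega>) \<longlonglongrightarrow> 0 \<and>
        (\<lambda>k. \<integral>\<^sup>+ x. ennreal (norm (jacobian (\<phi> k) (at x) - weak_gradient \<Omega> v x)) \<partial>lebesgue_on \<Omega>)
           \<longlonglongrightarrow> 0 \<and>
        (\<lambda>k. \<integral>\<^sup>+ x. ennreal (norm (\<phi> k x - T x)) \<partial>boundary_measure \<Omega>) \<longlonglongrightarrow> 0)"

end

theory Submission
  imports Defs
begin

text \<open>
  Near a boundary point the domain lies above a Lipschitz graph. Integrating along vertical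
  segments bounds a \<open>C\<^sup>1\<close> function on the graph by itself and its gradient in the domain:
  \<open>\<integral>\<^bsub>\<partial>\<Omega>\<^esub> u \<le> C \<integral>\<^bsub>\<Omega>\<^esub> (u + \<bar>\<nabla>u\<bar>)\<close> for \<open>u \<ge> 0\<close>. The modular inequality is this applied to
  \<open>u = B(\<bar>v\<bar>)\<close>, where \<open>B\<close> has the derivative \<open>B'(s) = A(s)/s\<close>. Then \<open>\<Delta>\<^sub>2\<close> makes \<open>B\<close> equivalent to \<open>A\<close>,
  and the gradient term is harmless because \<open>B'(s) t \<le> A(s) + A(t)\<close>: the slope \<open>A(s)/s\<close> is
  nondecreasing.

  The boundary integral is taken with respect to Hausdorff measure. Instead of parametrising the
  graph, the Hausdorff measure of a piece \<open>K\<close> of it is compared directly with the Lebesgue measure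
  of the tube of points between heights \<open>h\<close> and \<open>2h\<close> above \<open>K\<close>, by stacking disjoint balls
  (\<open>hausdorff_outer_lipschitz_graph\<close>). Caratheodory's criterion makes Borel sets measurable, and
  inner regularity extends the comparison from compact sets to integrals
  (\<open>nn_integral_hausdorff_graph_le\<close>). The values of \<open>u\<close> at the two ends of a vertical segment differ
  at most by the integral of its gradient. Averaging this over the tube, and covering the compact
  boundary by finitely many charts, gives \<open>trace_inequality_segment_gradient\<close>.

  A Sobolev function and its trace are only limits of smooth functions in \<open>W\<^sup>1\<^sup>,\<^sup>1\<close>, under which the
  integral of \<open>A\<close> need not converge. Therefore \<open>A\<close> is replaced by
  \<open>B\<^sub>M(s) = \<integral>\<^sub>0\<^sup>s min (A(r)/r) M dr\<close>, which is \<open>C\<^sup>1\<close> and Lipschitz. With \<open>B\<^sub>M\<close> the limit can be taken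
  (\<open>trace_inequality_truncated\<close>), with a constant independent of \<open>M\<close>. As \<open>M\<close> grows, \<open>B\<^sub>M(s)\<close>
  increases to a value that is at least \<open>A(s/2)\<close>, and \<open>\<Delta>\<^sub>2\<close> together with monotone convergence
  yields the inequality for \<open>A\<close>.
\<close>

section \<open>Borel sets are Hausdorff measurable\<close>

abbreviation (input) cover_cost :: "nat \<Rightarrow> (nat \<Rightarrow> 'a::metric_space set) \<Rightarrow> ennreal" where
  "cover_cost d C \<equiv>
     (\<Sum>i. if C i = {} then 0 else ennreal (unit_ball_vol (real d) * (diameter (C i) / 2) ^ d))"

lemma hausdorff_delta_le_cover_cost:
  assumes "\<And>i. bounded (C i)" "\<And>i. diameter (C i) \<le> \<delta>" "E \<subseteq> (\<Union>i. C i)"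
  shows "hausdorff_delta d \<delta> E \<le> cover_cost d C"
  unfolding hausdorff_delta_def using assms by (intro INF_lower) auto

lemma hausdorff_delta_mono_set:
  "E \<subseteq> F \<Longrightarrow> hausdorff_delta d \<delta> E \<le> hausdorff_delta d \<delta> F"
  unfolding hausdorff_delta_def by (rule INF_superset_mono) auto

lemma hausdorff_delta_antimono:
  "\<delta> \<le> \<delta>' \<Longrightarrow> hausdorff_delta d \<delta>' E \<le> hausdorff_delta d \<delta> E"
  unfolding hausdorff_delta_def by (rule INF_superset_mono) (auto intro: order_trans)

lemma hausdorff_delta_le_outer: "\<delta> > 0 \<Longrightarrow> hausdorff_delta d \<delta> E \<le> hausdorff_outer d E"
  unfolding hausdorff_outer_def by (rule SUP_upper) auto

lemma hausdorff_outer_mono: "E \<subseteq> F \<Longrightarrow> hausdorff_outer d E \<le> hausdorff_outer d F"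
  unfolding hausdorff_outer_def by (rule SUP_mono) (auto intro: hausdorff_delta_mono_set)

lemma hausdorff_outer_empty [simp]: "hausdorff_outer d {} = 0"
proof -
  have "hausdorff_delta d \<delta> ({} :: 'a set) \<le> 0" if "\<delta> > 0" for \<delta>
    using hausdorff_delta_le_cover_cost[of "\<lambda>_. {}" \<delta> "{}" d] that by (simp add: diameter_def)
  then show ?thesis
    unfolding hausdorff_outer_def by (intro antisym SUP_least) auto
qed

text \<open>Almost optimal covers of the single sets, enumerated together, cover the union.\<close>
lemma hausdorff_delta_countably_subadditive:
  "hausdorff_delta d \<delta> (\<Union>n. E n) \<le> (\<Sum>n. hausdorff_delta d \<delta> (E n))"
proof (rule ennreal_le_epsilon)
  fix \<epsilon> :: real
  assume fin: "(\<Sum>n. hausdorff_delta d \<delta> (E n)) < top" and "0 < \<epsilon>"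
  have near: "\<exists>C. (\<forall>i. bounded (C i) \<and> diameter (C i) \<le> \<delta>) \<and> E n \<subseteq> (\<Union>i. C i) \<and> cover_cost d C \<le> c"
    if "hausdorff_delta d \<delta> (E n) < c" for n c
    using that unfolding hausdorff_delta_def INF_less_iff by (auto intro: less_imp_le)
  have "\<exists>C. (\<forall>i. bounded (C i) \<and> diameter (C i) \<le> \<delta>) \<and> E n \<subseteq> (\<Union>i. C i) \<and>
      cover_cost d C \<le> hausdorff_delta d \<delta> (E n) + ennreal (\<epsilon> * (1/2) ^ Suc n)" for n
  proof -
    have "hausdorff_delta d \<delta> (E n) < top"
      using ennreal_suminf_lessD[OF fin] by simp
    then have "hausdorff_delta d \<delta> (E n) < hausdorff_delta d \<delta> (E n) + ennreal (\<epsilon> * (1/2) ^ Suc n)"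
      using \<open>0 < \<epsilon>\<close> by (cases "hausdorff_delta d \<delta> (E n)")
        (auto simp: ennreal_plus[symmetric] ennreal_less_iff simp del: ennreal_plus)
    then show ?thesis by (rule near)
  qed
  then have "\<forall>n. \<exists>C. (\<forall>i. bounded (C i) \<and> diameter (C i) \<le> \<delta>) \<and> E n \<subseteq> (\<Union>i. C i) \<and>
      cover_cost d C \<le> hausdorff_delta d \<delta> (E n) + ennreal (\<epsilon> * (1/2) ^ Suc n)"
    by (rule allI)
  from choice[OF this] obtain C where
    C': "\<forall>n. (\<forall>i. bounded (C n i) \<and> diameter (C n i) \<le> \<delta>) \<and> E n \<subseteq> (\<Union>i. C n i) \<and>
      cover_cost d (C n) \<le> hausdorff_delta d \<delta> (E n) + ennreal (\<epsilon> * (1/2) ^ Suc n)"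
    by (rule exE)
  have C: "\<And>n i. bounded (C n i)" "\<And>n i. diameter (C n i) \<le> \<delta>" "\<And>n. E n \<subseteq> (\<Union>i. C n i)"
      "\<And>n. cover_cost d (C n) \<le> hausdorff_delta d \<delta> (E n) + ennreal (\<epsilon> * (1/2) ^ Suc n)"
    using C' by simp_all
  define D where "D k = (case prod_decode k of (n, i) \<Rightarrow> C n i)" for k
  have "(\<Union>n. E n) \<subseteq> (\<Union>k. D k)"
  proof
    fix x assume "x \<in> (\<Union>n. E n)"
    then obtain n i where "x \<in> C n i" using C(3) by blast
    then have "x \<in> D (prod_encode (n, i))" by (simp add: D_def)
    then show "x \<in> (\<Union>k. D k)" by blast
  qed
  then have "hausdorff_delta d \<delta> (\<Union>n. E n) \<le> cover_cost d D"
    using C by (intro hausdorff_delta_le_cover_cost) (auto simp: D_def split: prod.split)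
  also have "\<dots> = (\<Sum>n. cover_cost d (C n))"
  proof -
    define f where "f = (\<lambda>(n, i). if C n i = {} then 0
      else ennreal (unit_ball_vol (real d) * (diameter (C n i) / 2) ^ d))"
    have "(\<Sum>k. f (prod_decode k)) = (\<Sum>n. cover_cost d (C n))"
      by (rule suminf_ennreal_2dimen) (simp add: f_def)
    moreover have "f (prod_decode k) = (if D k = {} then 0
      else ennreal (unit_ball_vol (real d) * (diameter (D k) / 2) ^ d))" for k
      by (simp add: f_def D_def split: prod.split)
    ultimately show ?thesis by simp
  qed
  also have "\<dots> \<le> (\<Sum>n. hausdorff_delta d \<delta> (E n) + ennreal (\<epsilon> * (1/2) ^ Suc n))"
    by (intro suminf_le C(4) summableI)
  also have "\<dots> = (\<Sum>n. hausdorff_delta d \<delta> (E n)) + (\<Sum>n. ennreal (\<epsilon> * (1/2) ^ Suc n))"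
    by (rule suminf_add[symmetric]) (auto intro: summableI)
  also have "(\<Sum>n. ennreal (\<epsilon> * (1/2) ^ Suc n)) = ennreal \<epsilon>"
    using \<open>0 < \<epsilon>\<close> sums_mult[OF power_half_series, of \<epsilon>] by (intro suminf_ennreal_eq) auto
  finally show "hausdorff_delta d \<delta> (\<Union>n. E n) \<le> (\<Sum>n. hausdorff_delta d \<delta> (E n)) + ennreal \<epsilon>" .
qed

lemma hausdorff_outer_countably_subadditive:
  "hausdorff_outer d (\<Union>n. E n) \<le> (\<Sum>n. hausdorff_outer d (E n))"
proof -
  have "hausdorff_delta d \<delta> (\<Union>n. E n) \<le> (\<Sum>n. hausdorff_outer d (E n))" if "\<delta> > 0" for \<delta>
    by (rule order_trans[OF hausdorff_delta_countably_subadditive])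
       (intro suminf_le summableI hausdorff_delta_le_outer that)
  then show ?thesis
    by (subst hausdorff_outer_def) (auto intro: SUP_least)
qed

text \<open>
  Once the covering sets are smaller than the gap between \<open>E\<close> and \<open>F\<close>, none of them meets both,
  so every cover of the union splits into a cover of \<open>E\<close> and one of \<open>F\<close>.
\<close>
lemma hausdorff_outer_metric_additive:
  assumes "s > 0" and sep: "\<And>x y. x \<in> E \<Longrightarrow> y \<in> F \<Longrightarrow> dist x y \<ge> s"
  shows "hausdorff_outer d E + hausdorff_outer d F \<le> hausdorff_outer d (E \<union> F)"
proof -
  have small: "hausdorff_delta d \<delta> E + hausdorff_delta d \<delta> F \<le> hausdorff_delta d \<delta> (E \<union> F)"
    if "0 < \<delta>" "\<delta> < s" for \<delta>
    unfolding hausdorff_delta_def[of d \<delta> "E \<union> F"]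
  proof (rule INF_greatest, clarify)
    fix C :: "nat \<Rightarrow> 'a set"
    assume C: "\<forall>i. bounded (C i) \<and> diameter (C i) \<le> \<delta>" "E \<union> F \<subseteq> (\<Union>i. C i)"
    define CE where "CE i = (if C i \<inter> E = {} then {} else C i)" for i
    define CF where "CF i = (if C i \<inter> E = {} then C i else {})" for i
    have E: "hausdorff_delta d \<delta> E \<le> cover_cost d CE"
    proof (intro hausdorff_delta_le_cover_cost subsetI)
      fix x assume "x \<in> E"
      then obtain i where "x \<in> C i" using C by blast
      with \<open>x \<in> E\<close> have "x \<in> CE i" by (auto simp: CE_def)
      then show "x \<in> (\<Union>i. CE i)" by blast
    qed (use C(1) \<open>0 < \<delta>\<close> in \<open>simp_all add: CE_def\<close>)
    have F: "hausdorff_delta d \<delta> F \<le> cover_cost d CF"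
    proof (intro hausdorff_delta_le_cover_cost subsetI)
      fix y assume "y \<in> F"
      then obtain i where i: "y \<in> C i" using C by blast
      have "C i \<inter> E = {}"
      proof (rule ccontr)
        assume "C i \<inter> E \<noteq> {}"
        then obtain x where x: "x \<in> C i" "x \<in> E" by blast
        have "dist x y \<le> diameter (C i)"
          using C(1) x i by (intro diameter_bounded_bound) auto
        moreover have "diameter (C i) \<le> \<delta>" using C(1) by blast
        ultimately show False using sep[OF x(2) \<open>y \<in> F\<close>] \<open>\<delta> < s\<close> by linarith
      qed
      then show "y \<in> (\<Union>i. CF i)" using i by (auto simp: CF_def)
    qed (use C(1) \<open>0 < \<delta>\<close> in \<open>simp_all add: CF_def\<close>)
    have "cover_cost d CE + cover_cost d CF = cover_cost d C"
      by (subst suminf_add) (auto simp: CE_def CF_def intro!: suminf_cong)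
    with add_mono[OF E F] show "hausdorff_delta d \<delta> E + hausdorff_delta d \<delta> F \<le> cover_cost d C"
      by simp
  qed
  have "hausdorff_delta d \<delta> E + hausdorff_delta d \<delta>' F \<le> hausdorff_outer d (E \<union> F)"
    if "\<delta> > 0" "\<delta>' > 0" for \<delta> \<delta>'
  proof -
    define \<eta> where "\<eta> = min (min \<delta> \<delta>') (s/2)"
    have \<eta>: "0 < \<eta>" "\<eta> < s" "\<eta> \<le> \<delta>" "\<eta> \<le> \<delta>'" using that \<open>s > 0\<close> by (auto simp: \<eta>_def)
    have "hausdorff_delta d \<delta> E + hausdorff_delta d \<delta>' F
        \<le> hausdorff_delta d \<eta> E + hausdorff_delta d \<eta> F"
      by (intro add_mono hausdorff_delta_antimono \<eta>)
    also have "\<dots> \<le> hausdorff_outer d (E \<union> F)"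
      using small[OF \<eta>(1,2)] hausdorff_delta_le_outer[OF \<eta>(1)] by (rule order_trans)
    finally show ?thesis .
  qed
  then show ?thesis
    unfolding hausdorff_outer_def[of d E] hausdorff_outer_def[of d F]
    by (subst ennreal_SUP_add_left[symmetric], simp, intro SUP_least)
       (subst ennreal_SUP_add_right, simp, intro SUP_least, simp)
qed

text \<open>
  Caratheodory's criterion. The part of \<open>X\<close> at distance at least \<open>1 / n\<close> from \<open>Z\<close> is separated from
  \<open>X \<inter> Z\<close>, so the two pieces add up correctly. What is missing from \<open>X - Z\<close> is a countable union
  of layers by distance to \<open>Z\<close>. Layers that are not adjacent are separated, hence their measures are
  summable and the missing part is small for large \<open>n\<close>.
\<close>
lemma lambda_system_UNIV_closed:
  fixes f :: "'a::metric_space set \<Rightarrow> ennreal"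
  assumes f0: "f {} = 0" and mono: "\<And>E F. E \<subseteq> F \<Longrightarrow> f E \<le> f F"
    and csub: "\<And>E. f (\<Union>n. E n) \<le> (\<Sum>n. f (E n))"
    and metric: "\<And>E F s. s > 0 \<Longrightarrow> (\<And>x y. x \<in> E \<Longrightarrow> y \<in> F \<Longrightarrow> dist x y \<ge> s) \<Longrightarrow> f E + f F \<le> f (E \<union> F)"
    and "closed Z"
  shows "Z \<in> lambda_system UNIV UNIV f"
proof -
  have "outer_measure_space UNIV f"
    using f0 mono csub
    by (auto simp: outer_measure_space_def positive_def increasing_def countably_subadditive_def)
  moreover have "ring_of_sets UNIV (UNIV :: 'a set set)"
    by (simp add: ring_of_sets_iff)
  ultimately have disj: "f (E \<union> F) \<le> f E + f F" if "E \<inter> F = {}" for E F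
    using ring_of_sets.countably_subadditive_subadditive[of UNIV UNIV f] that
    by (auto simp: outer_measure_space_def subadditive_def)
  have sub: "f (E \<union> F) \<le> f E + f F" for E F
  proof -
    have "f (E \<union> F) \<le> f E + f (F - E)" using disj[of E "F - E"] by simp
    also have "\<dots> \<le> f E + f F" by (intro add_left_mono mono) auto
    finally show ?thesis .
  qed
  have split: "f (X \<inter> Z) + f (X - Z) \<le> f X" for X
  proof (cases "Z = {} \<or> f X = top")
    case True
    then show ?thesis using f0 by auto
  next
    case False
    then have "Z \<noteq> {}" and fin: "f X < top" by (auto simp: less_top)
    define q where "q x = infdist x Z" for x
    have qd: "q x \<le> q y + dist x y" for x y unfolding q_def by (rule infdist_triangle)
    define D where "D n = {x \<in> X. 1 / Suc n \<le> q x}" for n :: nat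
    define R where "R k = {x \<in> X. 1 / Suc (Suc k) \<le> q x \<and> q x < 1 / Suc k}" for k :: nat
    \<comment> \<open>Every second layer is separated from the previous ones, so the layers of one parity have
      total measure at most \<open>f X\<close>.\<close>
    have layers: "(\<Sum>k<n. f (R (2 * k + p))) \<le> f {x \<in> X. 1 / (2 * real n + p) \<le> q x}"
      if "p > 0" for n p :: nat
    proof (induction n)
      case (Suc n)
      let ?B = "{x \<in> X. 1 / (2 * real n + p) \<le> q x}"
      have "f ?B + f (R (2 * n + p)) \<le> f (?B \<union> R (2 * n + p))"
      proof (rule metric)
        show "1 / (2 * real n + p) - 1 / (2 * real n + p + 1) > 0"
          using that by (simp add: field_simps add_pos_nonneg)
        fix x y assume "x \<in> ?B" "y \<in> R (2 * n + p)"
        then show "1 / (2 * real n + p) - 1 / (2 * real n + p + 1) \<le> dist x y"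
          using qd[of x y] by (auto simp: R_def algebra_simps)
      qed
      also have "\<dots> \<le> f {x \<in> X. 1 / (2 * real (Suc n) + p) \<le> q x}"
      proof (rule mono, safe)
        fix x assume "1 / (2 * real n + p) \<le> q x"
        moreover have "1 / (2 * real (Suc n) + p) \<le> 1 / (2 * real n + p)"
          using that by (intro divide_left_mono) (auto simp: add_nonneg_pos)
        ultimately show "1 / (2 * real (Suc n) + p) \<le> q x" by simp
      qed (auto simp: R_def algebra_simps)
      finally have "f ?B + f (R (2 * n + p)) \<le> f {x \<in> X. 1 / (2 * real (Suc n) + p) \<le> q x}" .
      with add_right_mono[OF Suc, of "f (R (2 * n + p))"] show ?case
        by (subst sum.lessThan_Suc) (rule order_trans)
    qed (simp add: f0)
    have "(\<Sum>k<n. f (R (k + 1))) \<le> f X + f X" for n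
    proof -
      have "(\<Sum>k<n. f (R (k + 1))) \<le> (\<Sum>k<2*n. f (R (k + 1)))"
        by (rule sum_mono2) auto
      also have "\<dots> = (\<Sum>k<n. f (R (2 * k + 1))) + (\<Sum>k<n. f (R (2 * k + 2)))"
        by (induction n) (auto simp: algebra_simps)
      also have "\<dots> \<le> f X + f X"
        using layers[of 1 n] layers[of 2 n]
        by (intro add_mono) (auto elim!: order_trans intro!: mono)
      finally show ?thesis .
    qed
    then have "(\<Sum>k. f (R (k + 1))) \<le> f X + f X"
      by (intro suminf_le_const summableI) auto
    then have fin': "(\<Sum>k. f (R (k + 1))) < top"
      using fin by (simp add: order_le_less_trans)
    define r where "r k = enn2real (f (R (k + 1)))" for k
    have r: "f (R (k + 1)) = ennreal (r k)" for k
      unfolding r_def using ennreal_suminf_lessD[OF fin', of k] by (simp add: less_top)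
    have r0: "0 \<le> r k" for k by (simp add: r_def)
    have sr: "summable r"
      using fin' r0 unfolding r by (intro summable_suminf_not_top) auto
    have main: "f (X \<inter> Z) + f (X - Z) \<le> f X + ennreal \<epsilon>" if "\<epsilon> > 0" for \<epsilon>
    proof -
      obtain n where n: "norm (\<Sum>k. r (k + n)) < \<epsilon>"
        using suminf_exist_split[OF \<open>\<epsilon> > 0\<close> sr] by blast
      have "X - Z \<subseteq> D (Suc n) \<union> (\<Union>k. R (k + n + 1))"
      proof
        fix x assume x: "x \<in> X - Z"
        have "q x > 0"
          using x \<open>closed Z\<close> \<open>Z \<noteq> {}\<close> infdist_pos_not_in_closed[of Z x] by (simp add: q_def)
        then have ex: "\<exists>k::nat. 1 / Suc (Suc k) \<le> q x"
        proof -
          obtain n where "1 / real (Suc n) < q x" using nat_approx_posE[OF \<open>q x > 0\<close>] .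
          moreover have "1 / real (Suc (Suc n)) \<le> 1 / Suc n" by (intro divide_left_mono) auto
          ultimately show ?thesis by (intro exI[of _ n]) linarith
        qed
        define k where "k = (LEAST k::nat. 1 / Suc (Suc k) \<le> q x)"
        have k: "1 / Suc (Suc k) \<le> q x" using LeastI_ex[OF ex] by (simp add: k_def)
        show "x \<in> D (Suc n) \<union> (\<Union>k. R (k + n + 1))"
        proof (cases "1 / Suc (Suc n) \<le> q x")
          case False
          have "n < k"
          proof (rule ccontr)
            assume "\<not> n < k"
            then have "1 / real (Suc (Suc n)) \<le> 1 / Suc (Suc k)"
              by (intro divide_left_mono) auto
            with k False show False by linarith
          qed
          then obtain j where j: "k = j + n + 1" using that[of "k - n - 1"] \<open>n < k\<close> by simp
          have "\<not> 1 / Suc (Suc (j + n)) \<le> q x"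
            using not_less_Least[of "j + n" "\<lambda>k. 1 / Suc (Suc k) \<le> q x"] j by (simp add: k_def)
          then have "x \<in> R (j + n + 1)" using x k j by (auto simp: R_def)
          then show ?thesis by blast
        qed (use x in \<open>auto simp: D_def\<close>)
      qed
      then have "f (X - Z) \<le> f (D (Suc n)) + f (\<Union>k. R (k + n + 1))"
        by (meson mono sub order_trans)
      also have "f (\<Union>k. R (k + n + 1)) \<le> (\<Sum>k. ennreal (r (k + n)))"
        using csub[of "\<lambda>k. R (k + n + 1)"] by (simp add: r[symmetric])
      also have "\<dots> = ennreal (\<Sum>k. r (k + n))"
        using r0 sr by (intro suminf_ennreal2) (auto simp: summable_iff_shift)
      also have "\<dots> \<le> ennreal \<epsilon>" using n by (intro ennreal_leI) auto
      finally have "f (X \<inter> Z) + f (X - Z) \<le> f (X \<inter> Z) + (f (D (Suc n)) + ennreal \<epsilon>)"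
        by (simp add: add_left_mono)
      also have "f (X \<inter> Z) + f (D (Suc n)) \<le> f (X \<inter> Z \<union> D (Suc n))"
      proof (rule metric)
        fix x y assume "x \<in> X \<inter> Z" "y \<in> D (Suc n)"
        then show "1 / Suc (Suc n) \<le> dist x y"
          using infdist_le[of x Z y] by (auto simp: D_def q_def dist_commute)
      qed simp
      then have "f (X \<inter> Z) + (f (D (Suc n)) + ennreal \<epsilon>) \<le> f (X \<inter> Z \<union> D (Suc n)) + ennreal \<epsilon>"
        by (simp add: add.assoc[symmetric] add_right_mono)
      also have "\<dots> \<le> f X + ennreal \<epsilon>"
        by (intro add_right_mono mono) (auto simp: D_def)
      finally show ?thesis .
    qed
    show ?thesis by (rule ennreal_le_epsilon) (rule main)
  qed
  have alg: "algebra UNIV (UNIV :: 'a set set)"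
    using algebra_Pow[of UNIV] by (simp add: Pow_UNIV)
  have "f (X \<inter> Z) + f (X - Z) = f X" for X
    using split[of X] sub[of "X \<inter> Z" "X - Z"] by (simp add: Int_Diff_Un antisym)
  then show ?thesis by (simp add: algebra.lambda_system_eq[OF alg])
qed

lemma
  fixes E :: "'a::metric_space set"
  shows borel_subset_sets_hausdorff:
      "sets (borel :: 'a measure) \<subseteq> sets (hausdorff_measure d)"
    and emeasure_hausdorff: "E \<in> sets borel \<Longrightarrow> emeasure (hausdorff_measure d) E = hausdorff_outer d E"
proof -
  let ?L = "lambda_system UNIV UNIV (hausdorff_outer d :: 'a set \<Rightarrow> ennreal)"
  have "sigma_algebra UNIV (UNIV :: 'a set set)"
    using sigma_algebra_Pow[of UNIV] by (simp add: Pow_UNIV)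
  then have ms: "measure_space UNIV ?L (hausdorff_outer d)"
    using hausdorff_outer_mono hausdorff_outer_countably_subadditive
    by (intro sigma_algebra.caratheodory_lemma)
       (auto simp: outer_measure_space_def positive_def increasing_def countably_subadditive_def)
  then interpret L: sigma_algebra UNIV ?L by (simp add: measure_space_def)
  have sets: "sets (hausdorff_measure d :: 'a measure) = ?L"
    by (simp add: hausdorff_measure_def L.sets_measure_of_eq)
  show sub: "sets (borel :: 'a measure) \<subseteq> sets (hausdorff_measure d)"
  proof -
    have "Collect closed \<subseteq> ?L"
      by (auto intro!: lambda_system_UNIV_closed hausdorff_outer_mono
          hausdorff_outer_countably_subadditive hausdorff_outer_metric_additive)
    then show ?thesis
      using L.sigma_sets_subset by (simp add: sets borel_eq_closed)
  qed
  show "emeasure (hausdorff_measure d) E = hausdorff_outer d E" if "E \<in> sets borel"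
    using sub that ms
    by (intro emeasure_measure_of[OF hausdorff_measure_def])
       (auto simp: sets measure_space_def)
qed

lemma space_hausdorff [simp]: "space (hausdorff_measure d) = UNIV"
  by (simp add: hausdorff_measure_def)

section \<open>The area of a Lipschitz graph is controlled by the volume of a tube above it\<close>

lemma hausdorff_delta_le_finite_balls:
  fixes E :: "'a::euclidean_space set"
  assumes "finite Y" "E \<subseteq> (\<Union>y\<in>Y. cball y \<rho>)" "0 \<le> \<rho>" "2 * \<rho> \<le> \<delta>"
  shows "hausdorff_delta d \<delta> E \<le> ennreal (real (card Y) * (unit_ball_vol (real d) * \<rho> ^ d))"
proof -
  obtain f where f: "bij_betw f {..<card Y} Y"
    using ex_bij_betw_nat_finite[OF \<open>finite Y\<close>] by (auto simp: atLeast0LessThan)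
  define C where "C i = (if i < card Y then cball (f i) \<rho> else {})" for i
  have "E \<subseteq> (\<Union>i. C i)"
  proof
    fix x assume "x \<in> E"
    then obtain y where "y \<in> Y" "x \<in> cball y \<rho>" using assms(2) by blast
    moreover then obtain i where "i < card Y" "y = f i"
      using f by (auto simp: bij_betw_def)
    ultimately show "x \<in> (\<Union>i. C i)" by (auto simp: C_def intro!: exI[of _ i])
  qed
  then have "hausdorff_delta d \<delta> E \<le> cover_cost d C"
    using assms by (intro hausdorff_delta_le_cover_cost) (auto simp: C_def)
  also have "\<dots> = (\<Sum>i<card Y. ennreal (unit_ball_vol (real d) * \<rho> ^ d))"
    using \<open>0 \<le> \<rho>\<close> by (subst suminf_finite[of "{..<card Y}"]) (auto simp: C_def)
  also have "\<dots> = ennreal (real (card Y) * (unit_ball_vol (real d) * \<rho> ^ d))"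
    using \<open>0 \<le> \<rho>\<close> by (simp add: ennreal_mult' ennreal_of_nat_eq_real_of_nat)
  finally show ?thesis .
qed

text \<open>
  A separated subset has at most one point in each set of a finite cover by small balls, so its
  size is bounded and a separated subset of greatest size exists. It cannot be enlarged, which is
  the covering property.
\<close>
lemma maximal_separated_subset:
  fixes K :: "'a::metric_space set"
  assumes "compact K" "\<rho> > 0"
  obtains Y where "finite Y" "Y \<subseteq> K"
    "\<And>x y. x \<in> Y \<Longrightarrow> y \<in> Y \<Longrightarrow> x \<noteq> y \<Longrightarrow> dist x y \<ge> \<rho>" "K \<subseteq> (\<Union>y\<in>Y. cball y \<rho>)"
proof -
  obtain N where N: "finite N" "K \<subseteq> (\<Union>x\<in>N. ball x (\<rho>/2))"
  proof -
    have "\<forall>x\<in>K. open (ball x (\<rho>/2))" "K \<subseteq> (\<Union>x\<in>K. ball x (\<rho>/2))" using \<open>\<rho> > 0\<close> by auto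
    from compactE_image[OF \<open>compact K\<close> this(1)[rule_format] this(2)] that show ?thesis by metis
  qed
  let ?P = "\<lambda>Y. Y \<subseteq> K \<and> finite Y \<and> (\<forall>x\<in>Y. \<forall>y\<in>Y. x \<noteq> y \<longrightarrow> dist x y \<ge> \<rho>)"
  have "card Y < card N + 1" if Y: "?P Y" for Y
  proof -
    have "\<forall>y\<in>Y. \<exists>x. x \<in> N \<and> dist x y < \<rho>/2" using Y N(2) by (force simp: ball_def)
    then obtain c where c: "\<And>y. y \<in> Y \<Longrightarrow> c y \<in> N \<and> dist (c y) y < \<rho>/2" by metis
    have "inj_on c Y"
    proof (rule inj_onI, rule ccontr)
      fix x y assume xy: "x \<in> Y" "y \<in> Y" "c x = c y" "x \<noteq> y"
      have "dist x y \<le> dist (c x) x + dist (c x) y" by (rule dist_triangle3)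
      then have "dist x y < \<rho>" using c[OF xy(1)] c[OF xy(2)] xy(3) by simp
      then show False using Y xy by force
    qed
    then have "card Y \<le> card N" using c N(1) by (intro card_inj_on_le[of c]) auto
    then show ?thesis by simp
  qed
  then obtain Y where Y: "?P Y" and max: "\<And>Z. ?P Z \<Longrightarrow> card Z \<le> card Y"
    using ex_has_greatest_nat[of ?P "{}" card "card N + 1"] by auto
  have cover: "K \<subseteq> (\<Union>y\<in>Y. cball y \<rho>)"
  proof (rule ccontr)
    assume "\<not> K \<subseteq> (\<Union>y\<in>Y. cball y \<rho>)"
    then obtain x where "x \<in> K" "x \<notin> (\<Union>y\<in>Y. cball y \<rho>)" by blast
    then have x: "x \<in> K" "\<And>y. y \<in> Y \<Longrightarrow> dist y x > \<rho>" by (auto simp: not_le)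
    have "x \<notin> Y" using x(2)[of x] \<open>\<rho> > 0\<close> by auto
    have "?P (insert x Y)"
      using Y x by (auto simp: dist_commute less_imp_le)
    from max[OF this] Y \<open>x \<notin> Y\<close> show False by auto
  qed
  show ?thesis using Y by (intro that[OF _ _ _ cover]) auto
qed

text \<open>
  The heights start at \<open>h\<close> and not at \<open>0\<close>, so that the closed tube over a piece of the boundary
  stays inside the domain.
\<close>
definition tube :: "'a::real_normed_vector \<Rightarrow> real \<Rightarrow> 'a set \<Rightarrow> 'a set" where
  "tube e h K = (\<lambda>(y, t). y + t *\<^sub>R e) ` (K \<times> {h..2 * h})"

lemma compact_tube: "compact K \<Longrightarrow> compact (tube e h K)"
  unfolding tube_def
  by (intro compact_continuous_image compact_Times compact_Icc)
     (auto intro!: continuous_intros simp: case_prod_beta)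

definition horizontal :: "'a::real_inner \<Rightarrow> 'a \<Rightarrow> 'a" where
  "horizontal e z = z - (z \<bullet> e) *\<^sub>R e"

lemma horizontal_add_vertical [simp]:
  "norm e = 1 \<Longrightarrow> horizontal e (z + t *\<^sub>R e) = horizontal e z"
  by (simp add: horizontal_def inner_add_left norm_eq_1 algebra_simps)

lemma horizontal_diff: "horizontal e x - horizontal e y = horizontal e (x - y)"
  by (simp add: horizontal_def inner_diff_left algebra_simps)

lemma horizontal_orthogonal: "norm e = 1 \<Longrightarrow> horizontal e z \<bullet> e = 0"
  by (simp add: horizontal_def inner_diff_left norm_eq_1)

lemma norm_horizontal_le:
  assumes "norm e = 1"
  shows "norm (horizontal e z) \<le> norm z"
proof -
  have "(norm z)\<^sup>2 = (norm (horizontal e z))\<^sup>2 + (z \<bullet> e)\<^sup>2"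
    using assms unfolding horizontal_def power2_norm_eq_inner
    by (simp add: norm_eq_1 algebra_simps inner_commute power2_eq_square)
  then have "(norm (horizontal e z))\<^sup>2 \<le> (norm z)\<^sup>2" by simp
  then show ?thesis by (rule power2_le_imp_le) simp
qed

text \<open>
  A covering ball of radius \<open>2 * (1 + L) * a\<close> is paid for by a column of about \<open>h / (2 * a)\<close> disjoint
  balls of radius \<open>a\<close>. The constant is \<open>h\<close> times the ratio of the cost of the covering ball in
  dimension \<open>d\<close> to the volume of the column in dimension \<open>d + 1\<close>, which does not depend on \<open>a\<close>.
\<close>
definition graph_area_const :: "nat \<Rightarrow> real \<Rightarrow> real" where
  "graph_area_const d L =
     2 * unit_ball_vol (real d) * (2 * (1 + L)) ^ d / unit_ball_vol (real (Suc d))"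

lemma graph_area_const_pos: "L \<ge> 0 \<Longrightarrow> graph_area_const d L > 0"
  by (simp add: graph_area_const_def)

text \<open>
  The centres of a maximal \<open>\<rho>\<close>-separated subset of a piece \<open>K\<close> of a Lipschitz graph have
  horizontal distances of at least a fixed multiple of \<open>\<rho>\<close>. Hence over each centre disjoint balls of
  radius comparable to \<open>\<rho>\<close> can be stacked to a column of height \<open>h\<close>, and the columns are disjoint.
  The number of centres, which bounds the Hausdorff measure of \<open>K\<close>, is thus bounded through the
  volume of a neighbourhood of the tube.
\<close>
lemma hausdorff_delta_lipschitz_graph:
  fixes K :: "'a::euclidean_space set"
  assumes "compact K" and e: "norm e = 1" and "L \<ge> 0" "h > 0" "a > 0"
    and graph: "\<And>x y. x \<in> K \<Longrightarrow> y \<in> K \<Longrightarrow> \<bar>(x - y) \<bullet> e\<bar> \<le> L * norm (horizontal e (x - y))"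
    and \<delta>: "4 * (1 + L) * a \<le> \<delta>"
    and N: "bounded N" "N \<in> sets lborel" "\<And>z. z \<in> tube e h K \<Longrightarrow> ball z a \<subseteq> N"
  shows "hausdorff_delta (DIM('a) - 1) \<delta> K
    \<le> ennreal (graph_area_const (DIM('a) - 1) L / h) * emeasure lborel N"
proof -
  define d where "d = DIM('a) - 1"
  have d: "DIM('a) = Suc d" using DIM_positive[where 'a='a] by (simp add: d_def)
  define \<rho> where "\<rho> = 2 * (1 + L) * a"
  have "\<rho> > 0" using assms by (simp add: \<rho>_def)
  obtain Y where Y: "finite Y" "Y \<subseteq> K" "K \<subseteq> (\<Union>y\<in>Y. cball y \<rho>)"
    and sep: "\<And>x y. x \<in> Y \<Longrightarrow> y \<in> Y \<Longrightarrow> x \<noteq> y \<Longrightarrow> dist x y \<ge> \<rho>"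
    using maximal_separated_subset[OF \<open>compact K\<close> \<open>\<rho> > 0\<close>] by metis
  \<comment> \<open>The centres at heights \<open>h + 2 * j * a\<close> with \<open>j < m\<close> are exactly those up to height \<open>2 * h\<close>.\<close>
  define m where "m = nat \<lfloor>h / (2 * a)\<rfloor> + 1"
  define B where "B = (\<lambda>(y, j::nat). ball (y + (h + 2 * real j * a) *\<^sub>R e) a)"
  have nn: "0 \<le> h / (2 * a)" using assms by simp
  have m: "h / (2 * a) \<le> real m" using nn unfolding m_def by linarith
  have height: "2 * real j * a \<le> h" if "j < m" for j
  proof -
    have "real j \<le> h / (2 * a)" using that nn unfolding m_def by linarith
    then show ?thesis using \<open>a > 0\<close> by (simp add: field_simps)
  qed
  have "disjoint_family_on B (Y \<times> {..<m})"
    unfolding disjoint_family_on_def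
  proof (intro ballI impI, rule ccontr)
    fix p q
    assume pq: "p \<in> Y \<times> {..<m}" "q \<in> Y \<times> {..<m}" "p \<noteq> q" and meet: "B p \<inter> B q \<noteq> {}"
    obtain x i where p: "p = (x, i)" by (cases p)
    obtain y j where q: "q = (y, j)" by (cases q)
    from p q pq have xy: "x \<in> Y" "y \<in> Y" "(x, i) \<noteq> (y, j)" by auto
    obtain z where "z \<in> ball (x + (h + 2 * real i * a) *\<^sub>R e) a"
        "z \<in> ball (y + (h + 2 * real j * a) *\<^sub>R e) a" using meet by (auto simp: B_def p q)
    then have "dist (x + (h + 2 * real i * a) *\<^sub>R e) (y + (h + 2 * real j * a) *\<^sub>R e) < a + a"
      by (intro dist_triangle_less_add[of _ z]) auto
    moreover have "x + (h + 2 * real i * a) *\<^sub>R e - (y + (h + 2 * real j * a) *\<^sub>R e)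
        = (x - y) + (2 * a * (real i - real j)) *\<^sub>R e"
      by (simp add: algebra_simps)
    ultimately have close: "norm ((x - y) + (2 * a * (real i - real j)) *\<^sub>R e) < 2 * a"
      by (simp add: dist_norm)
    show False
    proof (cases "x = y")
      case True
      then have "i \<noteq> j" using xy by auto
      then have "\<bar>real i - real j\<bar> \<ge> 1" by linarith
      then show False using close True e \<open>a > 0\<close> by (simp add: abs_mult)
    next
      case False
      \<comment> \<open>The columns over \<open>x\<close> and \<open>y\<close> can only meet if the horizontal distance is below \<open>2 * a\<close>;
        on the graph this forces \<open>x\<close> and \<open>y\<close> closer than \<open>\<rho>\<close>.\<close>
      have "norm (horizontal e (x - y)) < 2 * a"
        using norm_horizontal_le[OF e, of "(x - y) + (2 * a * (real i - real j)) *\<^sub>R e"] close e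
        by simp
      moreover have "\<bar>(x - y) \<bullet> e\<bar> \<le> L * norm (horizontal e (x - y))"
        using graph xy Y by blast
      moreover have "norm (x - y) \<le> norm (horizontal e (x - y)) + \<bar>(x - y) \<bullet> e\<bar>"
        using norm_triangle_ineq[of "horizontal e (x - y)" "((x - y) \<bullet> e) *\<^sub>R e"] e
        by (simp add: horizontal_def)
      moreover have "L * norm (horizontal e (x - y)) \<le> L * (2 * a)"
        using \<open>L \<ge> 0\<close> calculation(1) by (intro mult_left_mono) auto
      ultimately have "norm (x - y) < \<rho>" by (simp add: \<rho>_def algebra_simps)
      then show False using sep[OF xy(1,2) False] by (simp add: dist_norm)
    qed
  qed
  then have "(\<Sum>i\<in>Y \<times> {..<m}. emeasure lborel (B i)) = emeasure lborel (\<Union>(B ` (Y \<times> {..<m})))"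
    using Y(1) by (intro sum_emeasure) (auto simp: B_def)
  also have "\<dots> \<le> emeasure lborel N"
  proof (rule emeasure_mono[OF _ N(2)], clarify)
    fix z y j assume "z \<in> B (y, j)" "y \<in> Y" "j < m"
    then have "y + (h + 2 * real j * a) *\<^sub>R e \<in> tube e h K"
      using Y(2) height[of j] \<open>a > 0\<close> unfolding tube_def
      by (intro image_eqI[of _ _ "(y, h + 2 * real j * a)"]) auto
    from N(3)[OF this] \<open>z \<in> B (y, j)\<close> show "z \<in> N" unfolding B_def by auto
  qed
  also have "emeasure lborel N = ennreal (measure lborel N)"
    using emeasure_bounded_finite[OF N(1)] by (simp add: emeasure_eq_ennreal_measure)
  also have "(\<Sum>i\<in>Y \<times> {..<m}. emeasure lborel (B i))
      = ennreal (real (card Y) * real m * (unit_ball_vol (real (Suc d)) * a ^ Suc d))"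
  proof -
    have "emeasure lborel (B i) = ennreal (unit_ball_vol (real (Suc d)) * a ^ Suc d)" for i
      using \<open>a > 0\<close> by (simp add: B_def case_prod_beta emeasure_ball d del: power_Suc of_nat_Suc)
    then have "(\<Sum>i\<in>Y \<times> {..<m}. emeasure lborel (B i))
        = (\<Sum>i\<in>Y \<times> {..<m}. ennreal (unit_ball_vol (real (Suc d)) * a ^ Suc d))" by simp
    also have "\<dots> = ennreal (\<Sum>i\<in>Y \<times> {..<m}. unit_ball_vol (real (Suc d)) * a ^ Suc d)"
      using \<open>a > 0\<close> by (intro sum_ennreal) (auto simp del: power_Suc of_nat_Suc)
    finally show ?thesis by (simp add: card_cartesian_product del: power_Suc of_nat_Suc)
  qed
  finally have le: "real (card Y) * real m * (unit_ball_vol (real (Suc d)) * a ^ Suc d) \<le> measure lborel N"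
    by (subst (asm) ennreal_le_iff) auto
  have "real (card Y) * (h / (2 * a)) * (unit_ball_vol (real (Suc d)) * a ^ Suc d)
      \<le> real (card Y) * real m * (unit_ball_vol (real (Suc d)) * a ^ Suc d)"
    using m \<open>a > 0\<close> by (intro mult_right_mono mult_left_mono) auto
  with le have "real (card Y) * (h / (2 * a)) * (unit_ball_vol (real (Suc d)) * a ^ Suc d)
      \<le> measure lborel N" by (rule order_trans[rotated])
  then have le': "real (card Y) * a ^ d \<le> 2 / (h * unit_ball_vol (real (Suc d))) * measure lborel N"
    using \<open>a > 0\<close> \<open>h > 0\<close> by (simp add: field_simps del: of_nat_Suc)
  have "hausdorff_delta d \<delta> K \<le> ennreal (real (card Y) * (unit_ball_vol (real d) * \<rho> ^ d))"
    using Y \<open>\<rho> > 0\<close> \<delta> by (intro hausdorff_delta_le_finite_balls) (auto simp: \<rho>_def algebra_simps)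
  also have "\<dots> = ennreal (unit_ball_vol (real d) * (2 * (1 + L)) ^ d * (real (card Y) * a ^ d))"
    by (simp add: \<rho>_def power_mult_distrib mult_ac)
  also have "\<dots> \<le> ennreal (unit_ball_vol (real d) * (2 * (1 + L)) ^ d *
      (2 / (h * unit_ball_vol (real (Suc d))) * measure lborel N))"
    using le' \<open>L \<ge> 0\<close> by (intro ennreal_leI mult_left_mono) auto
  also have "\<dots> = ennreal (graph_area_const d L / h * measure lborel N)"
    by (simp add: graph_area_const_def mult_ac)
  also have "\<dots> = ennreal (graph_area_const d L / h) * emeasure lborel N"
    using emeasure_bounded_finite[OF N(1)]
    by (subst ennreal_mult'') (auto simp: emeasure_eq_ennreal_measure)
  finally show ?thesis by (simp add: d_def)
qed

text \<open>
  The closed neighbourhoods of the compact tube shrink to the tube, so the size of the covering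
  balls can be sent to zero.
\<close>
lemma hausdorff_outer_lipschitz_graph:
  fixes K :: "'a::euclidean_space set"
  assumes "compact K" and e: "norm e = 1" and "L \<ge> 0" "h > 0"
    and graph: "\<And>x y. x \<in> K \<Longrightarrow> y \<in> K \<Longrightarrow> \<bar>(x - y) \<bullet> e\<bar> \<le> L * norm (horizontal e (x - y))"
  shows "hausdorff_outer (DIM('a) - 1) K
    \<le> ennreal (graph_area_const (DIM('a) - 1) L / h) * emeasure lborel (tube e h K)"
proof (cases "K = {}")
  case False
  define T where "T = tube e h K"
  have T: "compact T" "T \<noteq> {}"
    using compact_tube[OF \<open>compact K\<close>] False \<open>h > 0\<close> by (auto simp: T_def tube_def)
  define N where "N n = {z. infdist z T \<le> 1 / real (Suc n)}" for n
  have "closed (N n)" for n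
    unfolding N_def by (intro closed_Collect_le continuous_intros)
  have bdd: "bounded (N n)" for n
  proof -
    obtain R where R: "\<And>x. x \<in> T \<Longrightarrow> norm x \<le> R"
      using compact_imp_bounded[OF T(1)] by (auto simp: bounded_iff)
    have "norm z \<le> R + 1" if "z \<in> N n" for z
    proof -
      obtain x where x: "x \<in> T" "infdist z T = dist z x"
        using infdist_attains_inf[OF compact_imp_closed[OF T(1)] T(2)] by metis
      have "1 / real (Suc n) \<le> 1" by simp
      then have "dist z x \<le> 1" using that x unfolding N_def mem_Collect_eq by linarith
      then show ?thesis using R[OF x(1)] norm_triangle_sub[of z x] by (simp add: dist_norm)
    qed
    then show ?thesis by (auto simp: bounded_iff)
  qed
  have "(\<Inter>n. N n) = T"
  proof (intro equalityI subsetI)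
    fix z assume z: "z \<in> (\<Inter>n. N n)"
    have "infdist z T \<le> 0"
    proof (rule ccontr)
      assume "\<not> infdist z T \<le> 0"
      then obtain n where "1 / real (Suc n) < infdist z T" using nat_approx_posE[of "infdist z T"] by auto
      moreover have "z \<in> N n" using z by blast
      ultimately show False by (simp add: N_def)
    qed
    then have "infdist z T = 0" using infdist_nonneg[of z T] by linarith
    then show "z \<in> T"
      using in_closed_iff_infdist_zero[OF compact_imp_closed[OF T(1)] T(2)] by blast
  qed (auto simp: N_def)
  moreover have "decseq N"
    unfolding decseq_def N_def by (auto elim!: order_trans intro!: divide_left_mono)
  ultimately have lim: "(\<lambda>n. emeasure lborel (N n)) \<longlonglongrightarrow> emeasure lborel T"
    using Lim_emeasure_decseq[of N lborel] \<open>\<And>n. closed (N n)\<close> emeasure_bounded_finite[OF bdd]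
    by (auto simp: less_top image_subset_iff)
  have "hausdorff_delta (DIM('a) - 1) \<delta> K
      \<le> ennreal (graph_area_const (DIM('a) - 1) L / h) * emeasure lborel T" if "\<delta> > 0" for \<delta>
  proof (rule tendsto_lowerbound)
    show "(\<lambda>n. ennreal (graph_area_const (DIM('a) - 1) L / h) * emeasure lborel (N n))
        \<longlonglongrightarrow> ennreal (graph_area_const (DIM('a) - 1) L / h) * emeasure lborel T"
      by (intro ennreal_tendsto_cmult lim) simp
    have "(\<lambda>n. 4 * (1 + L) * (1 / real (Suc n))) \<longlonglongrightarrow> 4 * (1 + L) * 0"
      by (intro tendsto_intros LIMSEQ_Suc[OF lim_1_over_n])
    then have "\<forall>\<^sub>F n in sequentially. 4 * (1 + L) * (1 / real (Suc n)) < \<delta>"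
      using that by (auto dest: order_tendstoD)
    then show "\<forall>\<^sub>F n in sequentially. hausdorff_delta (DIM('a) - 1) \<delta> K
        \<le> ennreal (graph_area_const (DIM('a) - 1) L / h) * emeasure lborel (N n)"
    proof eventually_elim
      case (elim n)
      show ?case
      proof (rule hausdorff_delta_lipschitz_graph[OF \<open>compact K\<close> e \<open>L \<ge> 0\<close> \<open>h > 0\<close> _ graph])
        show "ball z (1 / real (Suc n)) \<subseteq> N n" if "z \<in> tube e h K" for z
        proof
          fix x assume "x \<in> ball z (1 / real (Suc n))"
          then have "dist x z \<le> 1 / real (Suc n)" by (simp add: dist_commute)
          moreover have "infdist x T \<le> dist x z" using that unfolding T_def by (rule infdist_le)
          ultimately show "x \<in> N n" unfolding N_def mem_Collect_eq by (rule order_trans[rotated])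
        qed
      qed (use elim bdd \<open>closed (N n)\<close> in auto)
    qed
  qed simp
  then show ?thesis unfolding hausdorff_outer_def T_def by (auto intro: SUP_least)
qed simp

section \<open>The trace inequality for functions continuous up to the boundary\<close>

definition graph_projection :: "'a::real_inner \<Rightarrow> ('a \<Rightarrow> real) \<Rightarrow> 'a \<Rightarrow> 'a" where
  "graph_projection e \<gamma> z = horizontal e z + \<gamma> (horizontal e z) *\<^sub>R e"

text \<open>
  The function \<open>g\<close> is an upper gradient of \<open>u\<close> along straight segments. This is all that the
  trace inequality needs to know about the gradient of \<open>u\<close>.
\<close>
definition segment_gradient_bound :: "('a::euclidean_space \<Rightarrow> real) \<Rightarrow> ('a \<Rightarrow> real) \<Rightarrow> bool" where
  "segment_gradient_bound u g \<longleftrightarrow>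
     (\<forall>z e t. norm e = 1 \<longrightarrow> t \<ge> 0 \<longrightarrow>
        ennreal (u (z - t *\<^sub>R e)) \<le> ennreal (u z) + (\<integral>\<^sup>+s\<in>{0..t}. ennreal (g (z - s *\<^sub>R e)) \<partial>lborel))"

lemma nn_integral_translate:
  fixes f :: "'a::euclidean_space \<Rightarrow> ennreal"
  assumes [measurable]: "f \<in> borel_measurable borel"
  shows "(\<integral>\<^sup>+z. f (z - c) \<partial>lborel) = (\<integral>\<^sup>+z. f z \<partial>lborel)"
proof -
  have "(\<integral>\<^sup>+z. f z \<partial>lborel) = (\<integral>\<^sup>+z. f z \<partial>distr lborel borel ((+) (- c)))"
    by (simp add: lborel_distr_plus)
  also have "\<dots> = (\<integral>\<^sup>+z. f (- c + z) \<partial>lborel)"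
    by (subst nn_integral_distr) auto
  finally show ?thesis by simp
qed

text \<open>
  On a piece of a Lipschitz graph, the Hausdorff measure is dominated by the image of Lebesgue
  measure on the tube under vertical projection onto the graph. Compact sets are covered by the
  volume estimate for tubes, and inner regularity passes from them to all Borel sets.
\<close>
lemma nn_integral_hausdorff_graph_le:
  fixes F :: "'a::euclidean_space set" and \<gamma> :: "'a \<Rightarrow> real" and u :: "'a \<Rightarrow> ennreal"
  assumes "compact F" and e: "norm e = 1" and "h > 0"
    and lip: "L-lipschitz_on {z. z \<bullet> e = 0} \<gamma>"
    and graph: "\<And>y. y \<in> F \<Longrightarrow> y \<bullet> e = \<gamma> (horizontal e y)"
    and u [measurable]: "u \<in> borel_measurable borel"
  shows "(\<integral>\<^sup>+x\<in>F. u x \<partial>hausdorff_measure (DIM('a) - 1))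
    \<le> ennreal (graph_area_const (DIM('a) - 1) L / h)
      * (\<integral>\<^sup>+z\<in>tube e h F. u (graph_projection e \<gamma> z) \<partial>lborel)"
proof -
  define H where "H = (hausdorff_measure (DIM('a) - 1) :: 'a measure)"
  define c where "c = ennreal (graph_area_const (DIM('a) - 1) L / h)"
  let ?S = "tube e h F" and ?\<pi> = "graph_projection e \<gamma>"
  have L: "L \<ge> 0" using lip by (rule lipschitz_on_nonneg)
  have tri: "\<bar>(x - y) \<bullet> e\<bar> \<le> L * norm (horizontal e (x - y))" if "x \<in> F" "y \<in> F" for x y
    using lipschitz_on_normD[OF lip, of "horizontal e x" "horizontal e y"] graph that
      horizontal_orthogonal[OF e] by (simp add: inner_diff_left horizontal_diff)
  have "continuous_on UNIV (horizontal e)"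
    unfolding horizontal_def by (intro continuous_intros)
  moreover have "continuous_on UNIV (\<lambda>z. \<gamma> (horizontal e z))"
    by (rule continuous_on_compose2[OF lipschitz_on_continuous_on[OF lip] calculation])
       (auto simp: horizontal_orthogonal[OF e])
  ultimately have "continuous_on UNIV ?\<pi>"
    unfolding graph_projection_def by (intro continuous_intros)
  then have \<pi> [measurable]: "?\<pi> \<in> borel_measurable borel" by (rule borel_measurable_continuous_onI)
  have F: "F \<in> sets borel" and S: "?S \<in> sets borel"
    using \<open>compact F\<close> compact_tube[OF \<open>compact F\<close>] by (auto intro: borel_compact)
  have FH: "F \<in> sets H" using F borel_subset_sets_hausdorff unfolding H_def by blast
  have idH: "(\<lambda>x. x) \<in> measurable (restrict_space H F) borel"
    using borel_subset_sets_hausdorff unfolding H_def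
    by (intro measurable_restrict_space1) (auto simp: measurable_def)
  define M where "M = distr (restrict_space H F) borel (\<lambda>x. x)"
  define N where "N = scale_measure c (distr (restrict_space lborel ?S) borel ?\<pi>)"
  have sets: "sets M = sets borel" "sets N = sets borel" by (simp_all add: M_def N_def)
  have emM: "emeasure M B = hausdorff_outer (DIM('a) - 1) (B \<inter> F)" if "B \<in> sets borel" for B
    using that F FH unfolding M_def
    by (subst emeasure_distr[OF idH])
       (auto simp: emeasure_restrict_space space_restrict_space H_def emeasure_hausdorff Int_ac)
  have emN: "emeasure N B = c * emeasure lborel (?S \<inter> ?\<pi> -` B)" if "B \<in> sets borel" for B
    using that S unfolding N_def
    by (simp, subst emeasure_distr)
       (auto simp: emeasure_restrict_space space_restrict_space Int_ac intro: measurable_restrict_space1)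
  have comp: "hausdorff_outer (DIM('a) - 1) K \<le> c * emeasure lborel (tube e h K)"
    if "compact K" "K \<subseteq> F" for K
    unfolding c_def using that tri
    by (intro hausdorff_outer_lipschitz_graph[OF _ e L \<open>h > 0\<close>]) blast+
  have "emeasure M (space M) = hausdorff_outer (DIM('a) - 1) F"
    using emM[of UNIV] by (simp add: M_def)
  also have "\<dots> \<le> c * emeasure lborel ?S"
    by (rule comp[OF \<open>compact F\<close> order_refl])
  also have "\<dots> < top"
    using emeasure_compact_finite[OF compact_tube[OF \<open>compact F\<close>]]
    by (simp add: c_def ennreal_mult_less_top)
  finally have fin: "emeasure M (space M) \<noteq> \<infinity>" by simp
  have MN: "emeasure M B \<le> emeasure N B" if B: "B \<in> sets borel" for B
    unfolding inner_regular[OF sets(1) fin B]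
  proof (rule SUP_least, clarify)
    fix K assume K: "K \<subseteq> B" "compact K"
    have "emeasure M K \<le> c * emeasure lborel (tube e h (K \<inter> F))"
      using K comp[of "K \<inter> F"] compact_Int[OF K(2) \<open>compact F\<close>]
      by (simp add: emM borel_compact)
    also have "tube e h (K \<inter> F) \<subseteq> ?S \<inter> ?\<pi> -` B"
      using K(1) graph e by (auto simp: tube_def graph_projection_def horizontal_def[of e "y::'a" for y]
          inner_add_left norm_eq_1 algebra_simps)
    then have "c * emeasure lborel (tube e h (K \<inter> F)) \<le> c * emeasure lborel (?S \<inter> ?\<pi> -` B)"
      using S B measurable_sets[OF \<pi> B] by (intro mult_left_mono emeasure_mono) auto
    also have "\<dots> = emeasure N B" using emN[OF B] by simp
    finally show "emeasure M K \<le> emeasure N B" .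
  qed
  have "(\<integral>\<^sup>+x\<in>F. u x \<partial>H) = (\<integral>\<^sup>+x. u x \<partial>M)"
    using FH unfolding M_def
    by (subst nn_integral_distr[OF idH]) (simp_all add: nn_integral_restrict_space)
  also have "\<dots> \<le> (\<integral>\<^sup>+x. u x \<partial>N)"
  proof (rule nn_integral_mono_measure)
    have "emeasure M B \<le> emeasure N B" for B
      using MN by (cases "B \<in> sets borel") (auto simp: emeasure_notin_sets sets)
    then show "M \<le> N" using sets sets_eq_imp_space_eq[of M N]
      by (simp add: le_measure_iff le_fun_def)
  qed (simp add: sets)
  also have "\<dots> = c * (\<integral>\<^sup>+z\<in>?S. u (?\<pi> z) \<partial>lborel)"
    using S unfolding N_def
    by (subst nn_integral_scale_measure, simp, subst nn_integral_distr)
       (auto simp: nn_integral_restrict_space intro: measurable_restrict_space1)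
  finally show ?thesis unfolding H_def c_def .
qed

text \<open>
  The value at a boundary point is compared with the values on the vertical segment above it,
  and the comparison is averaged over the tube. For a fixed height the gradient term is a
  translate, so interchanging the integrals bounds it by an integral over the domain.
\<close>
lemma nn_integral_hausdorff_chart_le:
  fixes F \<Omega> :: "'a::euclidean_space set" and \<gamma> :: "'a \<Rightarrow> real" and u g :: "'a \<Rightarrow> real"
  assumes "compact F" and e: "norm e = 1" and "h > 0"
    and lip: "L-lipschitz_on {z. z \<bullet> e = 0} \<gamma>"
    and graph: "\<And>y. y \<in> F \<Longrightarrow> y \<bullet> e = \<gamma> (horizontal e y)"
    and column: "\<And>y t. y \<in> F \<Longrightarrow> 0 < t \<Longrightarrow> t \<le> 2 * h \<Longrightarrow> y + t *\<^sub>R e \<in> \<Omega>"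
    and "open \<Omega>"
    and u [measurable]: "u \<in> borel_measurable borel" and g [measurable]: "g \<in> borel_measurable borel"
    and ug: "segment_gradient_bound u g"
  shows "(\<integral>\<^sup>+x\<in>F. ennreal (u x) \<partial>hausdorff_measure (DIM('a) - 1))
    \<le> ennreal (graph_area_const (DIM('a) - 1) L / h * (1 + 2 * h))
      * ((\<integral>\<^sup>+x\<in>\<Omega>. ennreal (u x) \<partial>lborel) + (\<integral>\<^sup>+x\<in>\<Omega>. ennreal (g x) \<partial>lborel))"
proof -
  let ?S = "tube e h F" and ?c = "graph_area_const (DIM('a) - 1) L / h"
  define G where "G z = ennreal (g z) * indicator \<Omega> z" for z
  have \<Omega> [measurable]: "\<Omega> \<in> sets borel" using \<open>open \<Omega>\<close> by simp
  have G [measurable]: "G \<in> borel_measurable borel" unfolding G_def by measurable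
  have L: "L \<ge> 0" using lip by (rule lipschitz_on_nonneg)
  have pointwise: "ennreal (u (graph_projection e \<gamma> z)) * indicator ?S z
      \<le> ennreal (u z) * indicator \<Omega> z + (\<integral>\<^sup>+s\<in>{0..2*h}. G (z - s *\<^sub>R e) \<partial>lborel)" for z
  proof (cases "z \<in> ?S")
    case True
    then obtain y t where y: "y \<in> F" "h \<le> t" "t \<le> 2 * h" "z = y + t *\<^sub>R e"
      by (auto simp: tube_def)
    have "graph_projection e \<gamma> z = z - t *\<^sub>R e"
      using y graph[OF y(1)] e by (simp add: graph_projection_def) (simp add: horizontal_def)
    moreover have "0 \<le> t" using y \<open>h > 0\<close> by linarith
    ultimately have "ennreal (u (graph_projection e \<gamma> z))
        \<le> ennreal (u z) + (\<integral>\<^sup>+s\<in>{0..t}. ennreal (g (z - s *\<^sub>R e)) \<partial>lborel)"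
      using ug[unfolded segment_gradient_bound_def, rule_format, OF e, of t z] by simp
    also have "(\<integral>\<^sup>+s\<in>{0..t}. ennreal (g (z - s *\<^sub>R e)) \<partial>lborel)
        \<le> (\<integral>\<^sup>+s\<in>{0..2*h}. G (z - s *\<^sub>R e) \<partial>lborel)"
    proof (rule nn_integral_mono_AE, use AE_lborel_singleton[of t] in eventually_elim)
      fix s :: real assume "s \<noteq> t"
      have "z - s *\<^sub>R e \<in> \<Omega>" if "s \<in> {0..t}"
        using column[OF y(1), of "t - s"] y that \<open>s \<noteq> t\<close> by (auto simp: algebra_simps)
      then show "ennreal (g (z - s *\<^sub>R e)) * indicator {0..t} s \<le> G (z - s *\<^sub>R e) * indicator {0..2*h} s"
        using y by (auto simp: G_def indicator_def)
    qed
    finally have "ennreal (u (graph_projection e \<gamma> z))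
        \<le> ennreal (u z) + (\<integral>\<^sup>+s\<in>{0..2*h}. G (z - s *\<^sub>R e) \<partial>lborel)" by (simp add: add_left_mono)
    moreover have "z \<in> \<Omega>" using column[OF y(1), of t] y \<open>h > 0\<close> by simp
    ultimately show ?thesis using True by simp
  qed simp
  have [measurable]: "(\<lambda>(z, s). G (z - s *\<^sub>R e) * indicator {0..2*h} s)
      \<in> borel_measurable (lborel \<Otimes>\<^sub>M lborel)" by measurable
  have "(\<integral>\<^sup>+z. (\<integral>\<^sup>+s\<in>{0..2*h}. G (z - s *\<^sub>R e) \<partial>lborel) \<partial>lborel)
      = (\<integral>\<^sup>+s. (\<integral>\<^sup>+z. G (z - s *\<^sub>R e) * indicator {0..2*h} s \<partial>lborel) \<partial>lborel)"
    by (subst lborel_pair.Fubini') simp_all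
  also have "\<dots> = (\<integral>\<^sup>+s. (\<integral>\<^sup>+z. G z \<partial>lborel) * indicator {0..2*h} s \<partial>lborel)"
    by (simp add: nn_integral_multc nn_integral_translate)
  also have "\<dots> = ennreal (2 * h) * (\<integral>\<^sup>+z. G z \<partial>lborel)"
    using \<open>h > 0\<close> by (simp add: nn_integral_cmult mult.commute)
  finally have fub: "(\<integral>\<^sup>+z. (\<integral>\<^sup>+s\<in>{0..2*h}. G (z - s *\<^sub>R e) \<partial>lborel) \<partial>lborel)
      = ennreal (2 * h) * (\<integral>\<^sup>+z. G z \<partial>lborel)" .
  have "(\<integral>\<^sup>+z\<in>?S. ennreal (u (graph_projection e \<gamma> z)) \<partial>lborel)
      \<le> (\<integral>\<^sup>+z. ennreal (u z) * indicator \<Omega> z + (\<integral>\<^sup>+s\<in>{0..2*h}. G (z - s *\<^sub>R e) \<partial>lborel) \<partial>lborel)"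
    by (intro nn_integral_mono pointwise)
  also have "\<dots> = (\<integral>\<^sup>+x\<in>\<Omega>. ennreal (u x) \<partial>lborel) + ennreal (2 * h) * (\<integral>\<^sup>+z. G z \<partial>lborel)"
    by (subst nn_integral_add) (simp_all add: fub)
  also have "\<dots> \<le> ennreal (1 + 2 * h) * (\<integral>\<^sup>+x\<in>\<Omega>. ennreal (u x) \<partial>lborel)
      + ennreal (1 + 2 * h) * (\<integral>\<^sup>+z. G z \<partial>lborel)"
    using \<open>h > 0\<close> mult_right_mono[of 1 "ennreal (1 + 2 * h)" "\<integral>\<^sup>+x\<in>\<Omega>. ennreal (u x) \<partial>lborel"]
    by (intro add_mono mult_right_mono ennreal_leI) auto
  also have "\<dots> = ennreal (1 + 2 * h)
      * ((\<integral>\<^sup>+x\<in>\<Omega>. ennreal (u x) \<partial>lborel) + (\<integral>\<^sup>+x\<in>\<Omega>. ennreal (g x) \<partial>lborel))"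
    by (simp add: distrib_left G_def)
  finally have "(\<integral>\<^sup>+z\<in>?S. ennreal (u (graph_projection e \<gamma> z)) \<partial>lborel) \<le> \<dots>" .
  from order_trans[OF nn_integral_hausdorff_graph_le[OF \<open>compact F\<close> e \<open>h > 0\<close> lip graph] mult_left_mono[OF this]]
  have "(\<integral>\<^sup>+x\<in>F. ennreal (u x) \<partial>hausdorff_measure (DIM('a) - 1))
    \<le> ennreal ?c * (ennreal (1 + 2 * h)
      * ((\<integral>\<^sup>+x\<in>\<Omega>. ennreal (u x) \<partial>lborel) + (\<integral>\<^sup>+x\<in>\<Omega>. ennreal (g x) \<partial>lborel)))"
    by simp
  also have "ennreal ?c * (ennreal (1 + 2 * h) * X) = ennreal (?c * (1 + 2 * h)) * X" for X
    using \<open>h > 0\<close> graph_area_const_pos[OF L, of "DIM('a) - 1"]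
    by (subst ennreal_mult) (auto simp: mult.assoc)
  finally show ?thesis .
qed

text \<open>
  Inside the chart ball the boundary lies on the graph: points strictly above the graph belong to
  the open domain, and points strictly below it are not limits of points of the domain.
\<close>
lemma trace_inequality_near_boundary_point:
  fixes \<Omega> :: "(real^'n) set"
  assumes \<Omega>: "bounded_lipschitz_domain \<Omega>" and x: "x \<in> frontier \<Omega>"
  obtains r C where "r > 0" "C > 0"
    "\<And>u g. u \<in> borel_measurable borel \<Longrightarrow> g \<in> borel_measurable borel \<Longrightarrow> segment_gradient_bound u g \<Longrightarrow>
      (\<integral>\<^sup>+y\<in>frontier \<Omega> \<inter> cball x r. ennreal (u y) \<partial>hausdorff_measure (CARD('n) - 1))
        \<le> ennreal C * ((\<integral>\<^sup>+x\<in>\<Omega>. ennreal (u x) \<partial>lborel) + (\<integral>\<^sup>+x\<in>\<Omega>. ennreal (g x) \<partial>lborel))"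
proof -
  have op: "open \<Omega>" and bd: "bounded \<Omega>" using \<Omega> by (auto simp: bounded_lipschitz_domain_def)
  obtain r e \<gamma> L where "r > 0" and e: "norm e = 1" and lip: "L-lipschitz_on {z. z \<bullet> e = 0} \<gamma>"
    and "\<Omega> \<inter> ball x r = {y \<in> ball x r. y \<bullet> e > \<gamma> (y - (y \<bullet> e) *\<^sub>R e)}"
    using \<Omega> x unfolding bounded_lipschitz_domain_def by blast
  then have chart: "y \<in> \<Omega> \<longleftrightarrow> y \<bullet> e > \<gamma> (horizontal e y)" if "y \<in> ball x r" for y
    using that unfolding horizontal_def by blast
  have cont: "continuous_on UNIV (\<lambda>y. y \<bullet> e - \<gamma> (horizontal e y))"
  proof -
    have "continuous_on UNIV (\<lambda>z. \<gamma> (horizontal e z))"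
    proof (rule continuous_on_compose2[OF lipschitz_on_continuous_on[OF lip]])
      show "continuous_on UNIV (horizontal e)"
        unfolding horizontal_def by (intro continuous_intros)
    qed (auto simp: horizontal_orthogonal[OF e])
    then show ?thesis by (intro continuous_intros)
  qed
  \<comment> \<open>With radius \<open>r / 3\<close> and columns of height \<open>2 * (r / 6) = r / 3\<close>, everything stays in the ball
    where the chart describes the domain.\<close>
  define F where "F = frontier \<Omega> \<inter> cball x (r/3)"
  have "compact F"
    using compact_frontier_bounded[OF bd] by (auto simp: F_def intro: compact_Int)
  have F: "y \<in> ball x r" "y \<in> frontier \<Omega>" if "y \<in> F" for y
    using that \<open>r > 0\<close> by (auto simp: F_def)
  have graph: "y \<bullet> e = \<gamma> (horizontal e y)" if "y \<in> F" for y
  proof (rule antisym)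
    have "y \<notin> \<Omega>" using F[OF that] op by (auto simp: frontier_def interior_open)
    then show "y \<bullet> e \<le> \<gamma> (horizontal e y)" using chart[OF F(1)[OF that]] by simp
    show "\<gamma> (horizontal e y) \<le> y \<bullet> e"
    proof (rule ccontr)
      assume "\<not> \<gamma> (horizontal e y) \<le> y \<bullet> e"
      moreover have "open {y. y \<bullet> e - \<gamma> (horizontal e y) < 0}"
        by (intro open_Collect_less cont continuous_intros)
      ultimately have "open (ball x r \<inter> {y. y \<bullet> e - \<gamma> (horizontal e y) < 0})"
        "y \<in> ball x r \<inter> {y. y \<bullet> e - \<gamma> (horizontal e y) < 0}"
        using F(1)[OF that] by auto
      moreover have "y \<in> closure \<Omega>" using F[OF that] by (simp add: frontier_def)
      ultimately have "ball x r \<inter> {y. y \<bullet> e - \<gamma> (horizontal e y) < 0} \<inter> \<Omega> \<noteq> {}"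
        using open_Int_closure_eq_empty[of "ball x r \<inter> {y. y \<bullet> e - \<gamma> (horizontal e y) < 0}" \<Omega>]
        by auto
      then show False using chart by fastforce
    qed
  qed
  have column: "y + t *\<^sub>R e \<in> \<Omega>" if "y \<in> F" "0 < t" "t \<le> 2 * (r/6)" for y t
  proof -
    have "dist x (y + t *\<^sub>R e) \<le> dist x y + dist y (y + t *\<^sub>R e)" by (rule dist_triangle)
    then have "y + t *\<^sub>R e \<in> ball x r"
      using that e \<open>r > 0\<close> by (simp add: F_def dist_norm)
    moreover have "(y + t *\<^sub>R e) \<bullet> e > \<gamma> (horizontal e (y + t *\<^sub>R e))"
      using graph[OF that(1)] that e by (simp add: inner_add_left norm_eq_1)
    ultimately show ?thesis using chart by blast
  qed
  show ?thesis
  proof (rule that)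
    have "0 < r / 6" using \<open>r > 0\<close> by simp
    show "0 < r / 3" using \<open>r > 0\<close> by simp
    show "0 < graph_area_const (CARD('n) - 1) L / (r/6) * (1 + 2 * (r/6))"
      using \<open>r > 0\<close> graph_area_const_pos[OF lipschitz_on_nonneg[OF lip]] by simp
    fix u g :: "real^'n \<Rightarrow> real"
    assume ug: "u \<in> borel_measurable borel" "g \<in> borel_measurable borel" "segment_gradient_bound u g"
    show "(\<integral>\<^sup>+y\<in>frontier \<Omega> \<inter> cball x (r/3). ennreal (u y) \<partial>hausdorff_measure (CARD('n) - 1))
        \<le> ennreal (graph_area_const (CARD('n) - 1) L / (r/6) * (1 + 2 * (r/6)))
          * ((\<integral>\<^sup>+x\<in>\<Omega>. ennreal (u x) \<partial>lborel) + (\<integral>\<^sup>+x\<in>\<Omega>. ennreal (g x) \<partial>lborel))"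
      using nn_integral_hausdorff_chart_le[OF \<open>compact F\<close> e \<open>0 < r/6\<close> lip graph column op ug]
      by (simp add: F_def)
  qed
qed

lemma nn_integral_boundary_measure:
  fixes \<Omega> :: "(real^'n) set"
  shows "(\<integral>\<^sup>+x. f x \<partial>boundary_measure \<Omega>)
    = (\<integral>\<^sup>+x\<in>frontier \<Omega>. f x \<partial>hausdorff_measure (CARD('n) - 1))"
proof -
  have "frontier \<Omega> \<in> sets (hausdorff_measure (CARD('n) - 1))"
    using borel_subset_sets_hausdorff borel_closed[OF frontier_closed, of \<Omega>] by blast
  then show ?thesis unfolding boundary_measure_def by (simp add: nn_integral_restrict_space)
qed

lemma nn_integral_lebesgue_on_open:
  fixes f :: "'a::euclidean_space \<Rightarrow> ennreal"
  assumes "open \<Omega>"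
  shows "(\<integral>\<^sup>+x. f x \<partial>lebesgue_on \<Omega>) = (\<integral>\<^sup>+x\<in>\<Omega>. f x \<partial>lborel)"
  using assms lmeasurable_open
  by (simp add: nn_integral_restrict_space nn_integral_completion borel_open)

lemma borel_measurable_boundary_measure:
  fixes f :: "real^'n \<Rightarrow> 'b::topological_space"
  assumes "f \<in> borel_measurable borel"
  shows "f \<in> borel_measurable (boundary_measure \<Omega>)"
  unfolding boundary_measure_def
proof (rule measurable_restrict_space1)
  show "f \<in> borel_measurable (hausdorff_measure (CARD('n) - 1))"
    using assms borel_subset_sets_hausdorff by (auto simp: measurable_def)
qed

text \<open>The boundary is compact, so finitely many of the local inequalities add up to a global one.\<close>
proposition trace_inequality_segment_gradient:
  fixes \<Omega> :: "(real^'n) set"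
  assumes \<Omega>: "bounded_lipschitz_domain \<Omega>"
  obtains C where "C > 0"
    "\<And>u g. u \<in> borel_measurable borel \<Longrightarrow> g \<in> borel_measurable borel \<Longrightarrow> segment_gradient_bound u g \<Longrightarrow>
      (\<integral>\<^sup>+y. ennreal (u y) \<partial>boundary_measure \<Omega>)
        \<le> ennreal C * ((\<integral>\<^sup>+x. ennreal (u x) \<partial>lebesgue_on \<Omega>) + (\<integral>\<^sup>+x. ennreal (g x) \<partial>lebesgue_on \<Omega>))"
proof -
  have op: "open \<Omega>" and bd: "bounded \<Omega>" using \<Omega> by (auto simp: bounded_lipschitz_domain_def)
  let ?H = "hausdorff_measure (CARD('n) - 1) :: (real^'n) measure"
  define I where "I u g = (\<integral>\<^sup>+x\<in>\<Omega>. ennreal (u x) \<partial>lborel) + (\<integral>\<^sup>+x\<in>\<Omega>. ennreal (g x) \<partial>lborel)"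
    for u g :: "real^'n \<Rightarrow> real"
  have "\<forall>x\<in>frontier \<Omega>. \<exists>r C. r > 0 \<and> C > 0 \<and> (\<forall>u g. u \<in> borel_measurable borel \<longrightarrow>
      g \<in> borel_measurable borel \<longrightarrow> segment_gradient_bound u g \<longrightarrow>
      (\<integral>\<^sup>+y\<in>frontier \<Omega> \<inter> cball x r. ennreal (u y) \<partial>?H) \<le> ennreal C * I u g)"
  proof
    fix x assume "x \<in> frontier \<Omega>"
    from trace_inequality_near_boundary_point[OF \<Omega> this] obtain r C where "r > 0" "C > 0"
      "\<And>u g. u \<in> borel_measurable borel \<Longrightarrow> g \<in> borel_measurable borel \<Longrightarrow> segment_gradient_bound u g \<Longrightarrow>
      (\<integral>\<^sup>+y\<in>frontier \<Omega> \<inter> cball x r. ennreal (u y) \<partial>?H) \<le> ennreal C * I u g"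
      unfolding I_def by blast
    then show "\<exists>r C. r > 0 \<and> C > 0 \<and> (\<forall>u g. u \<in> borel_measurable borel \<longrightarrow>
      g \<in> borel_measurable borel \<longrightarrow> segment_gradient_bound u g \<longrightarrow>
      (\<integral>\<^sup>+y\<in>frontier \<Omega> \<inter> cball x r. ennreal (u y) \<partial>?H) \<le> ennreal C * I u g)" by blast
  qed
  then obtain r C where r: "\<And>x. x \<in> frontier \<Omega> \<Longrightarrow> r x > 0" and C: "\<And>x. x \<in> frontier \<Omega> \<Longrightarrow> C x > 0"
    and est: "\<And>x u g. x \<in> frontier \<Omega> \<Longrightarrow> u \<in> borel_measurable borel \<Longrightarrow> g \<in> borel_measurable borel \<Longrightarrow>
      segment_gradient_bound u g \<Longrightarrow>
      (\<integral>\<^sup>+y\<in>frontier \<Omega> \<inter> cball x (r x). ennreal (u y) \<partial>?H) \<le> ennreal (C x) * I u g"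
    unfolding bchoice_iff by blast
  have "frontier \<Omega> \<subseteq> (\<Union>x\<in>frontier \<Omega>. ball x (r x))" using r by force
  then obtain X where X: "X \<subseteq> frontier \<Omega>" "finite X" "frontier \<Omega> \<subseteq> (\<Union>x\<in>X. ball x (r x))"
    using compactE_image[OF compact_frontier_bounded[OF bd], of "frontier \<Omega>" "\<lambda>x. ball x (r x)"]
    by auto
  show ?thesis
  proof (rule that)
    show "0 < 1 + (\<Sum>x\<in>X. C x)" using C X by (intro add_pos_nonneg sum_nonneg) (auto intro: less_imp_le)
    fix u g :: "real^'n \<Rightarrow> real"
    assume ug: "u \<in> borel_measurable borel" "g \<in> borel_measurable borel" "segment_gradient_bound u g"
    have meas: "(\<lambda>y. ennreal (u y) * indicator (frontier \<Omega> \<inter> cball x (r x)) y) \<in> borel_measurable ?H" for x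
    proof -
      have "(\<lambda>y. ennreal (u y) * indicator (frontier \<Omega> \<inter> cball x (r x)) y) \<in> borel_measurable borel"
      proof -
        have [measurable]: "frontier \<Omega> \<in> sets borel" "cball x (r x) \<in> sets borel" by auto
        show ?thesis using ug by measurable
      qed
      then show ?thesis using borel_subset_sets_hausdorff by (auto simp: measurable_def)
    qed
    have "(\<integral>\<^sup>+y\<in>frontier \<Omega>. ennreal (u y) \<partial>?H)
        \<le> (\<integral>\<^sup>+y. (\<Sum>x\<in>X. ennreal (u y) * indicator (frontier \<Omega> \<inter> cball x (r x)) y) \<partial>?H)"
    proof (rule nn_integral_mono)
      fix y
      show "ennreal (u y) * indicator (frontier \<Omega>) y
          \<le> (\<Sum>x\<in>X. ennreal (u y) * indicator (frontier \<Omega> \<inter> cball x (r x)) y)"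
      proof (cases "y \<in> frontier \<Omega>")
        case True
        then obtain x where "x \<in> X" "y \<in> ball x (r x)" using X by blast
        then have "ennreal (u y) * indicator (frontier \<Omega>) y
            = ennreal (u y) * indicator (frontier \<Omega> \<inter> cball x (r x)) y"
          using True by simp
        also have "\<dots> \<le> (\<Sum>x\<in>X. ennreal (u y) * indicator (frontier \<Omega> \<inter> cball x (r x)) y)"
          using \<open>x \<in> X\<close> X(2) by (intro member_le_sum) auto
        finally show ?thesis .
      qed simp
    qed
    also have "\<dots> = (\<Sum>x\<in>X. \<integral>\<^sup>+y\<in>frontier \<Omega> \<inter> cball x (r x). ennreal (u y) \<partial>?H)"
      by (intro nn_integral_sum meas)
    also have "\<dots> \<le> (\<Sum>x\<in>X. ennreal (C x) * I u g)"
      using X(1) ug by (intro sum_mono est) auto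
    also have "\<dots> = ennreal (\<Sum>x\<in>X. C x) * I u g"
      using C X(1) by (subst sum_ennreal[symmetric]) (auto simp: sum_distrib_right intro: less_imp_le)
    also have "\<dots> \<le> ennreal (1 + (\<Sum>x\<in>X. C x)) * I u g"
      by (intro mult_right_mono ennreal_leI) auto
    finally show "(\<integral>\<^sup>+y. ennreal (u y) \<partial>boundary_measure \<Omega>)
      \<le> ennreal (1 + (\<Sum>x\<in>X. C x))
        * ((\<integral>\<^sup>+x. ennreal (u x) \<partial>lebesgue_on \<Omega>) + (\<integral>\<^sup>+x. ennreal (g x) \<partial>lebesgue_on \<Omega>))"
      by (simp add: nn_integral_boundary_measure nn_integral_lebesgue_on_open[OF op] I_def)
  qed
qed

section \<open>A smoothed and truncated N-function\<close>

text \<open>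
  The slope \<open>A s / s\<close> is nondecreasing and continuous, unlike the derivative of \<open>A\<close>. Its truncated
  primitive is therefore continuously differentiable and Lipschitz, and increases with the
  truncation level to a function between \<open>A (s / 2)\<close> and \<open>A s\<close>.
\<close>
definition truncated_slope :: "(real \<Rightarrow> real) \<Rightarrow> real \<Rightarrow> real \<Rightarrow> real" where
  "truncated_slope A M s = min (A s / s) M"

definition truncated_primitive :: "(real \<Rightarrow> real) \<Rightarrow> real \<Rightarrow> real \<Rightarrow> real" where
  "truncated_primitive A M s = integral {0..s} (truncated_slope A M)"

locale N_function_locale =
  fixes A :: "real \<Rightarrow> real"
  assumes N: "N_function A"
begin

lemma A_zero [simp]: "A 0 = 0" and A_pos: "s > 0 \<Longrightarrow> A s > 0"
  using N by (auto simp: N_function_def)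

lemma A_nonneg: "s \<ge> 0 \<Longrightarrow> A s \<ge> 0"
  using A_pos[of s] by (cases "s = 0") auto

text \<open>Convexity on the segment from \<open>0\<close> to \<open>t\<close>, where \<open>A\<close> vanishes at the left end.\<close>
lemma slope_mono:
  assumes "0 \<le> s" "s \<le> t"
  shows "A s / s \<le> A t / t"
proof (cases "s = 0 \<or> t = 0")
  case False
  then have st: "0 < s" "0 < t" "s \<le> t" using assms by auto
  have "convex_on {0..} A" using N by (simp add: N_function_def)
  from convex_onD[OF this, of "s / t" 0 t] st
  have "A s \<le> (s / t) * A t" by simp
  then show ?thesis using st by (simp add: field_simps)
qed (use assms A_nonneg[of t] in auto)

text \<open>
  Away from the origin this is the continuity of convex functions. At the origin, where the
  quotient has the value \<open>0 / 0 = 0\<close>, it is the vanishing of the slope of an N-function.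
\<close>
lemma continuous_on_slope: "continuous_on {0..} (\<lambda>s. A s / s)"
  unfolding continuous_on_eq_continuous_within
proof
  fix s :: real assume "s \<in> {0..}"
  show "continuous (at s within {0..}) (\<lambda>s. A s / s)"
  proof (cases "s = 0")
    case True
    then show ?thesis
      using N by (simp add: continuous_within N_function_def at_within_Ici_at_right)
  next
    case False
    have "convex_on {0<..} A"
      using N by (intro convex_on_subset[of "{0..}" A "{0<..}"]) (auto simp: N_function_def)
    then have "continuous_on {0<..} A" by (intro convex_on_continuous) auto
    then have "isCont A s"
      using False \<open>s \<in> {0..}\<close> by (auto simp: continuous_on_eq_continuous_at)
    then have "isCont (\<lambda>s. A s / s) s" using False by (intro continuous_intros) auto
    then show ?thesis by (rule continuous_at_imp_continuous_within)
  qed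
qed

lemma continuous_on_A: "continuous_on {0..} A"
proof -
  have "continuous_on {0..} (\<lambda>s. s * (A s / s))"
    by (intro continuous_intros continuous_on_slope)
  also have "(\<lambda>s. s * (A s / s)) = A" by (auto simp: fun_eq_iff)
  finally show ?thesis .
qed

lemma continuous_on_A_norm: "continuous_on UNIV (\<lambda>x::'a::real_normed_vector. A (norm x))"
  by (rule continuous_on_compose2[OF continuous_on_A continuous_on_norm_id]) auto

context
  fixes M :: real
  assumes M: "M \<ge> 0"
begin

abbreviation "b \<equiv> truncated_slope A M"
abbreviation "B \<equiv> truncated_primitive A M"

lemma continuous_on_truncated_slope: "continuous_on {0..} b"
  unfolding truncated_slope_def by (intro continuous_intros continuous_on_slope)

lemma truncated_slope_bounds: "s \<ge> 0 \<Longrightarrow> 0 \<le> b s" "b s \<le> M" "b s \<le> A s / s"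
  using M A_nonneg[of s] by (auto simp: truncated_slope_def)

lemma truncated_slope_mono: "0 \<le> s \<Longrightarrow> s \<le> t \<Longrightarrow> b s \<le> b t"
  using slope_mono[of s t] by (auto simp: truncated_slope_def)

lemma truncated_slope_zero [simp]: "b 0 = 0"
  using M by (simp add: truncated_slope_def)

lemma truncated_slope_integrable: "0 \<le> s \<Longrightarrow> b integrable_on {s..t}"
  by (intro integrable_continuous_interval continuous_on_subset[OF continuous_on_truncated_slope]) auto

lemma primitive_diff: "0 \<le> s \<Longrightarrow> s \<le> t \<Longrightarrow> B t - B s = integral {s..t} b"
  unfolding truncated_primitive_def
  using Henstock_Kurzweil_Integration.integral_combine[of 0 s t b] truncated_slope_integrable[of 0 t] by simp

lemma primitive_zero [simp]: "B 0 = 0"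
  by (simp add: truncated_primitive_def)

lemma primitive_diff_bounds:
  assumes "0 \<le> s" "s \<le> t"
  shows "(t - s) * b s \<le> B t - B s" "B t - B s \<le> (t - s) * b t"
proof -
  have "integral {s..t} (\<lambda>_. b s) \<le> integral {s..t} b"
    using assms by (intro integral_le truncated_slope_integrable) (auto intro: truncated_slope_mono)
  then show "(t - s) * b s \<le> B t - B s" using assms by (simp add: primitive_diff)
  have "integral {s..t} b \<le> integral {s..t} (\<lambda>_. b t)"
    using assms by (intro integral_le truncated_slope_integrable) (auto intro: truncated_slope_mono)
  then show "B t - B s \<le> (t - s) * b t" using assms by (simp add: primitive_diff)
qed

lemma primitive_mono: "0 \<le> s \<Longrightarrow> s \<le> t \<Longrightarrow> B s \<le> B t"
  using order_trans[OF mult_nonneg_nonneg primitive_diff_bounds(1), of t s] truncated_slope_bounds(1)[of s] by simp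

lemma primitive_nonneg: "0 \<le> s \<Longrightarrow> 0 \<le> B s"
  using primitive_mono[of 0 s] by simp

lemma primitive_lipschitz:
  assumes "0 \<le> s" "0 \<le> t"
  shows "B t \<le> B s + M * \<bar>t - s\<bar>"
proof (cases "s \<le> t")
  case True
  have "(t - s) * b t \<le> (t - s) * M" using True truncated_slope_bounds(2) by (intro mult_left_mono) auto
  then show ?thesis using primitive_diff_bounds(2)[OF assms(1) True] True by (simp add: mult.commute)
next
  case False
  then have "B t \<le> B s" using primitive_mono[of t s] assms by simp
  moreover have "0 \<le> M * \<bar>t - s\<bar>" using M by simp
  ultimately show ?thesis by linarith
qed

lemma primitive_le_A: "0 \<le> s \<Longrightarrow> B s \<le> A s"
  using primitive_diff_bounds(2)[of 0 s] mult_left_mono[OF truncated_slope_bounds(3)[of s], of s]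
  by (cases "s = 0") auto

text \<open>
  A form of Young's inequality whose second term is Lipschitz in \<open>s\<close>: it survives limits of
  \<open>s\<close> in mean, which \<open>A s\<close> would not.
\<close>
lemma truncated_slope_young:
  assumes "0 \<le> s" "0 \<le> t"
  shows "b s * t \<le> A t + B (2 * s)"
proof (cases "t \<le> s")
  case True
  have "b s * t \<le> (2 * s - s) * b s"
    using True truncated_slope_bounds(1)[OF assms(1)] by (simp add: mult.commute mult_right_mono)
  also have "\<dots> \<le> B (2 * s)"
    using primitive_diff_bounds(1)[of s "2 * s"] primitive_nonneg[of s] assms by simp
  finally show ?thesis using A_nonneg[OF assms(2)] by simp
next
  case False
  have "b s * t \<le> (A t / t) * t"
    using False assms truncated_slope_bounds(3)[of s] slope_mono[of s t] by (intro mult_right_mono) auto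
  then show ?thesis using False assms primitive_nonneg[of "2 * s"] by simp
qed

text \<open>Below the slope \<open>M\<close> the primitive is comparable to \<open>A\<close>.\<close>
lemma A_half_le_primitive:
  assumes "0 \<le> s" "A (s / 2) / (s / 2) \<le> M"
  shows "A (s / 2) \<le> B s"
proof -
  have "b (s / 2) = A (s / 2) / (s / 2)" using assms by (simp add: truncated_slope_def)
  then show ?thesis
    using primitive_diff_bounds(1)[of "s/2" s] primitive_nonneg[of "s/2"] assms by (cases "s = 0") auto
qed

lemma primitive_has_real_derivative:
  assumes "s > 0"
  shows "(B has_real_derivative b s) (at s)"
proof -
  have "((\<lambda>u. integral {0..u} b) has_real_derivative b s) (at s within {0..s+1})"
    using assms
    by (intro integral_has_real_derivative continuous_on_subset[OF continuous_on_truncated_slope]) auto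
  then have "(B has_real_derivative b s) (at s within {0..s+1})"
    by (simp add: truncated_primitive_def[abs_def])
  then show ?thesis using assms by (subst (asm) at_within_Icc_at) auto
qed

lemma primitive_mono_level:
  assumes "M \<le> M'" "0 \<le> s"
  shows "B s \<le> truncated_primitive A M' s"
proof -
  have "truncated_slope A M' integrable_on {0..s}"
    unfolding truncated_slope_def
    by (intro integrable_continuous_interval continuous_intros continuous_on_subset[OF continuous_on_slope]) auto
  then show ?thesis
    unfolding truncated_primitive_def using assms
    by (intro integral_le truncated_slope_integrable) (auto simp: truncated_slope_def)
qed

lemma continuous_on_truncated_slope_norm: "continuous_on UNIV (\<lambda>x::'a::real_normed_vector. b (norm x))"
  by (rule continuous_on_compose2[OF continuous_on_truncated_slope continuous_on_norm_id]) auto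

lemma continuous_on_primitive_norm: "continuous_on UNIV (\<lambda>x::'a::real_normed_vector. B (norm x))"
proof (rule continuous_on_compose2[of "{0..}" B])
  have "M-lipschitz_on {0..} B"
  proof (rule lipschitz_onI)
    fix s t :: real assume "s \<in> {0..}" "t \<in> {0..}"
    then show "dist (B s) (B t) \<le> M * dist s t"
      using primitive_lipschitz[of s t] primitive_lipschitz[of t s]
      by (simp add: dist_real_def abs_minus_commute[of s t])
  qed (rule M)
  then show "continuous_on {0..} B" by (rule lipschitz_on_continuous_on)
qed (auto intro: continuous_on_norm_id)

text \<open>
  At the origin, where the norm is not differentiable, the derivative is \<open>0\<close> because the slope of the
  primitive tends to \<open>0\<close> there.
\<close>
lemma primitive_norm_has_derivative:
  fixes x :: "'a::real_inner"
  shows "\<exists>F'. ((\<lambda>x. B (norm x)) has_derivative F') (at x) \<and> (\<forall>v. \<bar>F' v\<bar> \<le> b (norm x) * norm v)"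
proof (cases "x = 0")
  case False
  have "((\<lambda>x. B (norm x)) has_derivative (\<lambda>v. b (norm x) * (v \<bullet> sgn x))) (at x)"
    using has_derivative_compose[OF has_derivative_norm[OF False] primitive_has_real_derivative[of "norm x", unfolded has_field_derivative_def]]
      False by (simp add: mult.commute)
  moreover have "\<bar>b (norm x) * (v \<bullet> sgn x)\<bar> \<le> b (norm x) * norm v" for v
    using Cauchy_Schwarz_ineq2[of v "sgn x"] truncated_slope_bounds(1)[of "norm x"] False
    by (simp add: abs_mult norm_sgn mult_left_mono)
  ultimately show ?thesis by blast
next
  case True
  have "((\<lambda>x::'a. B (norm x)) has_derivative (\<lambda>_. 0)) (at 0)"
    unfolding has_derivative_at
  proof (intro conjI)
    have "(\<lambda>h::'a. norm (B (norm (0 + h)) - B (norm (0::'a)) - 0) / norm h) \<midarrow>0\<rightarrow> 0"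
    proof (rule tendsto_sandwich[of "\<lambda>_. 0"])
      have "B (norm h) / norm h \<le> b (norm h)" for h :: 'a
        using primitive_diff_bounds(2)[of 0 "norm h"] truncated_slope_bounds(1)[of "norm h"]
        by (cases "h = 0") (auto simp: field_simps)
      then show "\<forall>\<^sub>F h::'a in at 0. norm (B (norm (0 + h)) - B (norm (0::'a)) - 0) / norm h \<le> b (norm h)"
        by (simp add: primitive_nonneg)
      show "((\<lambda>h::'a. b (norm h)) \<longlongrightarrow> 0) (at 0)"
        using continuous_on_truncated_slope_norm[where 'a='a, unfolded continuous_on_def, rule_format, of 0]
        by simp
    qed auto
    then show "(\<lambda>h::'a. norm (B (norm (0 + h)) - B (norm (0::'a)) - 0) / norm h) \<midarrow>0\<rightarrow> 0" .
  qed simp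
  then show ?thesis using True by (intro exI[of _ "\<lambda>_. 0"]) simp
qed

end

end

section \<open>Gradient bounds along segments for compositions with smooth maps\<close>

lemma smooth_vector_has_derivative_jacobian:
  fixes \<phi> :: "real^'n \<Rightarrow> real^'m"
  assumes sm: "\<And>i. smooth (\<lambda>x. \<phi> x $ i)"
  shows "(\<phi> has_derivative (\<lambda>v. jacobian \<phi> (at x) *v v)) (at x)"
    and "continuous_on UNIV (\<lambda>x. jacobian \<phi> (at x))"
proof -
  let ?D = "\<lambda>i x. frechet_derivative (\<lambda>x. \<phi> x $ i) (at x)"
  have C1: "C_k (Suc 0) (\<lambda>x. \<phi> x $ i)" for i
    using sm unfolding smooth_def by blast
  then have part: "continuous_on UNIV (\<lambda>x. ?D i x (axis j 1))" for i j by simp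
  have "((\<lambda>x. \<phi> x $ i) has_derivative ?D i x) (at x)" for i x
    using C1[of i] by (simp add: frechet_derivative_works[symmetric])
  then have D: "(\<phi> has_derivative (\<lambda>v. \<chi> i. ?D i x v)) (at x)" for x
    by (subst has_derivative_componentwise_within) (auto simp: Basis_vec_def inner_axis)
  then have "\<phi> differentiable (at x)" by (rule differentiableI)
  then show "(\<phi> has_derivative (\<lambda>v. jacobian \<phi> (at x) *v v)) (at x)"
    by (simp add: jacobian_works)
  have "jacobian \<phi> (at x) = (\<chi> i j. ?D i x (axis j 1))" for x
    by (simp add: frechet_derivative_at[OF D[of x], symmetric] jacobian_def matrix_def)
  then show "continuous_on UNIV (\<lambda>x. jacobian \<phi> (at x))"
    using part by (simp add: continuous_on_vec_lambda)
qed

lemma norm_matrix_vector_mult_le: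
  fixes A :: "real^'n^'m" and x :: "real^'n"
  shows "norm (A *v x) \<le> norm A * norm x"
proof -
  have "norm (A *v x) = L2_set (\<lambda>i. \<bar>A $ i \<bullet> x\<bar>) UNIV"
    by (simp add: norm_vec_def matrix_vector_mul_component)
  also have "\<dots> \<le> L2_set (\<lambda>i. norm (A $ i) * norm x) UNIV"
    by (intro L2_set_mono Cauchy_Schwarz_ineq2) auto
  also have "\<dots> = norm A * norm x"
    by (simp add: norm_vec_def[of A] L2_set_left_distrib)
  finally show ?thesis .
qed

text \<open>
  Along a segment \<open>u\<close> minus the integral of \<open>g\<close> is nonincreasing. Arguing by monotonicity and not by
  the fundamental theorem requires no integrability of the derivative of \<open>u\<close>.
\<close>
lemma segment_gradient_boundI:
  fixes u g :: "'a::euclidean_space \<Rightarrow> real"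
  assumes deriv: "\<And>x. \<exists>U'. (u has_derivative U') (at x) \<and> (\<forall>v. \<bar>U' v\<bar> \<le> g x * norm v)"
    and g: "continuous_on UNIV g"
  shows "segment_gradient_bound u g"
  unfolding segment_gradient_bound_def
proof (intro allI impI)
  fix z e :: 'a and t :: real
  assume e: "norm e = 1" and t: "0 \<le> t"
  define w where "w s = u (z - s *\<^sub>R e)" for s
  define G where "G s = g (z - s *\<^sub>R e)" for s
  have w: "\<exists>w'. (w has_real_derivative w') (at s) \<and> \<bar>w'\<bar> \<le> G s" for s
  proof -
    obtain U' where U: "(u has_derivative U') (at (z - s *\<^sub>R e))" "\<And>v. \<bar>U' v\<bar> \<le> g (z - s *\<^sub>R e) * norm v"
      using deriv by blast
    have "((\<lambda>s. z - s *\<^sub>R e) has_derivative (\<lambda>h. - (h *\<^sub>R e))) (at s)"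
      by (auto intro!: derivative_eq_intros)
    from has_derivative_compose[OF this U(1)]
    have "(w has_derivative (\<lambda>h. U' (- (h *\<^sub>R e)))) (at s)" unfolding w_def .
    moreover have "U' (- (h *\<^sub>R e)) = U' (- e) * h" for h
      using linear_scale[OF has_derivative_linear[OF U(1)], of h "- e"] by simp
    ultimately have "(w has_real_derivative U' (- e)) (at s)"
      by (simp add: has_field_derivative_def)
    moreover have "\<bar>U' (- e)\<bar> \<le> G s" using U(2)[of "- e"] e by (simp add: G_def)
    ultimately show ?thesis by blast
  qed
  have contG: "continuous_on {0..t} G"
    unfolding G_def by (intro continuous_on_compose2[OF g] continuous_intros) auto
  have G0: "G s \<ge> 0" for s using w[of s] by fastforce
  have "w t - integral {0..t} G \<le> w 0 - integral {0..0} G"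
  proof (rule DERIV_nonpos_imp_decreasing_open[OF t])
    fix s assume s: "0 < s" "s < t"
    obtain w' where w': "(w has_real_derivative w') (at s)" "\<bar>w'\<bar> \<le> G s" using w by blast
    have "((\<lambda>s. integral {0..s} G) has_real_derivative G s) (at s within {0..t})"
      using s by (intro integral_has_real_derivative contG) auto
    then have "((\<lambda>s. integral {0..s} G) has_real_derivative G s) (at s)"
      using s by (simp add: at_within_Icc_at)
    with w' show "\<exists>y. ((\<lambda>s. w s - integral {0..s} G) has_real_derivative y) (at s) \<and> y \<le> 0"
      by (intro exI[of _ "w' - G s"]) (auto intro!: DERIV_diff)
  next
    have "continuous_on {0..t} w"
      using w DERIV_isCont by (intro continuous_at_imp_continuous_on) blast
    then show "continuous_on {0..t} (\<lambda>s. w s - integral {0..s} G)"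
      by (intro continuous_intros indefinite_integral_continuous_1 integrable_continuous_interval contG)
  qed
  then have "w t \<le> w 0 + integral {0..t} G" by simp
  moreover have "0 \<le> integral {0..t} G"
    using G0 by (intro integral_nonneg integrable_continuous_interval contG) auto
  ultimately have "ennreal (w t) \<le> ennreal (max 0 (w 0) + integral {0..t} G)"
    by (intro ennreal_leI) linarith
  also have "\<dots> = ennreal (w 0) + ennreal (integral {0..t} G)"
    using \<open>0 \<le> integral {0..t} G\<close> by (subst ennreal_plus) (auto simp: max_def ennreal_neg)
  also have "ennreal (integral {0..t} G) = (\<integral>\<^sup>+s\<in>{0..t}. ennreal (G s) \<partial>lborel)"
    using G0 contG
    by (intro nn_integral_has_integral_lebesgue'[symmetric] integrable_integral integrable_continuous_interval)
       auto
  finally show "ennreal (u (z - t *\<^sub>R e)) \<le> ennreal (u z) + (\<integral>\<^sup>+s\<in>{0..t}. ennreal (g (z - s *\<^sub>R e)) \<partial>lborel)"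
    by (simp add: w_def G_def)
qed

lemma (in N_function_locale) segment_gradient_bound_primitive:
  fixes \<phi> :: "real^'n \<Rightarrow> real^'m"
  assumes M: "M \<ge> 0" and sm: "\<And>i. smooth (\<lambda>x. \<phi> x $ i)"
  shows "segment_gradient_bound (\<lambda>x. truncated_primitive A M (norm (\<phi> x)))
    (\<lambda>x. truncated_slope A M (norm (\<phi> x)) * norm (jacobian \<phi> (at x)))"
proof (rule segment_gradient_boundI)
  note \<phi> = smooth_vector_has_derivative_jacobian[OF sm]
  have cont: "continuous_on UNIV \<phi>"
    using \<phi>(1) by (auto intro!: continuous_at_imp_continuous_on has_derivative_continuous)
  show "continuous_on UNIV (\<lambda>x. truncated_slope A M (norm (\<phi> x)) * norm (jacobian \<phi> (at x)))"
    by (intro continuous_intros \<phi>(2) continuous_on_compose2[OF continuous_on_truncated_slope_norm[OF M] cont]) auto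
  fix x
  obtain F' where F: "((\<lambda>x. truncated_primitive A M (norm x)) has_derivative F') (at (\<phi> x))"
    "\<And>v. \<bar>F' v\<bar> \<le> truncated_slope A M (norm (\<phi> x)) * norm v"
    using primitive_norm_has_derivative[OF M, of "\<phi> x"] by blast
  have "\<bar>F' (jacobian \<phi> (at x) *v v)\<bar>
      \<le> truncated_slope A M (norm (\<phi> x)) * norm (jacobian \<phi> (at x)) * norm v" for v
  proof -
    have "\<bar>F' (jacobian \<phi> (at x) *v v)\<bar>
        \<le> truncated_slope A M (norm (\<phi> x)) * norm (jacobian \<phi> (at x) *v v)" by (rule F)
    also have "\<dots> \<le> truncated_slope A M (norm (\<phi> x)) * (norm (jacobian \<phi> (at x)) * norm v)"
      by (intro mult_left_mono norm_matrix_vector_mult_le truncated_slope_bounds(1) M) auto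
    finally show ?thesis by (simp add: mult.assoc)
  qed
  with has_derivative_compose[OF \<phi>(1) F(1)]
  show "\<exists>U'. ((\<lambda>x. truncated_primitive A M (norm (\<phi> x))) has_derivative U') (at x) \<and>
      (\<forall>v. \<bar>U' v\<bar> \<le> truncated_slope A M (norm (\<phi> x)) * norm (jacobian \<phi> (at x)) * norm v)"
    by blast
qed

section \<open>The modular trace inequality\<close>

text \<open>
  For a function \<open>g\<close> that may fail to be measurable, the nonnegative integral is a lower integral
  and not subadditive, but adding one measurable function is still harmless. This applies to
  the distance from a smooth function to a Sobolev function of which only the norm is known to be
  measurable.
\<close>
lemma nn_integral_le_add_cmult:
  fixes f :: "'a \<Rightarrow> ennreal" and c :: real
  assumes f: "f \<in> borel_measurable M" "\<And>x. f x < top" and "c > 0"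
    and le: "\<And>x. x \<in> space M \<Longrightarrow> h x \<le> f x + ennreal c * g x"
  shows "(\<integral>\<^sup>+x. h x \<partial>M) \<le> (\<integral>\<^sup>+x. f x \<partial>M) + ennreal c * (\<integral>\<^sup>+x. g x \<partial>M)"
  unfolding nn_integral_def[of M h]
proof (rule SUP_least, clarify)
  fix s assume s: "simple_function M s" "s \<le> h"
  define r where "r x = ennreal (1 / c) * (s x - f x)" for x
  have [measurable]: "s \<in> borel_measurable M" "f \<in> borel_measurable M"
    using s(1) f(1) by (auto simp: borel_measurable_simple_function)
  have [measurable]: "r \<in> borel_measurable M" unfolding r_def by measurable
  have cancel: "ennreal c * (ennreal (1 / c) * y) = y" "ennreal (1 / c) * (ennreal c * y) = y" for y
    using \<open>c > 0\<close> by (simp_all add: mult.assoc[symmetric] ennreal_mult[symmetric])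
  have "integral\<^sup>S M s = (\<integral>\<^sup>+x. s x \<partial>M)" using s(1) by (simp add: nn_integral_eq_simple_integral)
  also have "\<dots> \<le> (\<integral>\<^sup>+x. f x + ennreal c * r x \<partial>M)"
  proof (rule nn_integral_mono)
    fix x
    show "s x \<le> f x + ennreal c * r x"
    proof (cases "f x \<le> s x")
      case False
      then show ?thesis by (intro add_increasing2) auto
    qed (simp add: r_def cancel add_diff_inverse_ennreal)
  qed
  also have "\<dots> = (\<integral>\<^sup>+x. f x \<partial>M) + ennreal c * (\<integral>\<^sup>+x. r x \<partial>M)"
    using f(1) by (simp add: nn_integral_add nn_integral_cmult)
  also have "(\<integral>\<^sup>+x. r x \<partial>M) \<le> (\<integral>\<^sup>+x. g x \<partial>M)"
  proof (rule nn_integral_mono)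
    fix x assume x: "x \<in> space M"
    have "s x \<le> f x + ennreal c * g x" using le[OF x] s(2) by (auto simp: le_fun_def intro: order_trans)
    then have "s x - f x \<le> ennreal c * g x"
      using f(2)[of x] by (simp add: ennreal_minus_le_iff less_top[symmetric])
    then have "r x \<le> ennreal (1 / c) * (ennreal c * g x)"
      unfolding r_def by (rule mult_left_mono) simp
    then show "r x \<le> g x" by (simp add: cancel)
  qed
  finally show "integral\<^sup>S M s \<le> (\<integral>\<^sup>+x. f x \<partial>M) + ennreal c * (\<integral>\<^sup>+x. g x \<partial>M)"
    by (simp add: add_left_mono mult_left_mono)
qed

text \<open>
  The smooth approximations converge only in \<open>W\<^sup>1\<^sup>,\<^sup>1\<close>, which gives no control of \<open>A\<close> along them. The
  truncated primitive is Lipschitz, so its integrals on the boundary and in the domain pass to the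
  limit. In the gradient term, the error \<open>jacobian - weak_gradient\<close> is multiplied by a bounded
  slope, and Young's inequality splits the remaining product into a term with \<open>A\<close> of the weak
  gradient, which does not depend on the approximation, and a Lipschitz function of the
  approximation. The resulting constant does not depend on the truncation level.
\<close>
lemma (in N_function_locale) trace_inequality_truncated:
  fixes \<Omega> :: "(real^'n) set" and v T :: "real^'n \<Rightarrow> real^'m"
  assumes C: "C > 0" and trace: "\<And>u g. u \<in> borel_measurable borel \<Longrightarrow> g \<in> borel_measurable borel \<Longrightarrow>
      segment_gradient_bound u g \<Longrightarrow> (\<integral>\<^sup>+y. ennreal (u y) \<partial>boundary_measure \<Omega>)
        \<le> ennreal C * ((\<integral>\<^sup>+x. ennreal (u x) \<partial>lebesgue_on \<Omega>) + (\<integral>\<^sup>+x. ennreal (g x) \<partial>lebesgue_on \<Omega>))"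
    and M: "M > 0" and \<kappa>: "\<kappa> > 0" "\<And>s. s \<ge> 0 \<Longrightarrow> A (2 * s) \<le> \<kappa> * A s"
    and v: "(\<lambda>x. norm (v x)) \<in> borel_measurable (lebesgue_on \<Omega>)"
    and G: "(\<lambda>x. norm (weak_gradient \<Omega> v x)) \<in> borel_measurable (lebesgue_on \<Omega>)"
    and T: "has_trace \<Omega> v T"
  shows "(\<integral>\<^sup>+x. ennreal (truncated_primitive A M (norm (T x))) \<partial>boundary_measure \<Omega>)
    \<le> ennreal (C * (1 + \<kappa>)) * ((\<integral>\<^sup>+x. ennreal (A (norm (weak_gradient \<Omega> v x))) \<partial>lebesgue_on \<Omega>)
       + (\<integral>\<^sup>+x. ennreal (A (norm (v x))) \<partial>lebesgue_on \<Omega>))"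
proof -
  let ?G = "weak_gradient \<Omega> v" and ?\<Omega> = "lebesgue_on \<Omega>" and ?bd = "boundary_measure \<Omega>"
  let ?B = "truncated_primitive A M" and ?b = "truncated_slope A M"
  have M0: "M \<ge> 0" using M by simp
  obtain \<phi> :: "nat \<Rightarrow> real^'n \<Rightarrow> real^'m" where
    smooth: "\<And>k i. smooth (\<lambda>x. \<phi> k x $ i)" and
    X: "(\<lambda>k. \<integral>\<^sup>+x. ennreal (norm (\<phi> k x - v x)) \<partial>?\<Omega>) \<longlonglongrightarrow> 0" and
    Y: "(\<lambda>k. \<integral>\<^sup>+x. ennreal (norm (jacobian (\<phi> k) (at x) - ?G x)) \<partial>?\<Omega>) \<longlonglongrightarrow> 0" and
    Z: "(\<lambda>k. \<integral>\<^sup>+x. ennreal (norm (\<phi> k x - T x)) \<partial>?bd) \<longlonglongrightarrow> 0"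
    using T unfolding has_trace_def by blast
  define X where "X k = (\<integral>\<^sup>+x. ennreal (norm (\<phi> k x - v x)) \<partial>?\<Omega>)" for k
  define Y where "Y k = (\<integral>\<^sup>+x. ennreal (norm (jacobian (\<phi> k) (at x) - ?G x)) \<partial>?\<Omega>)" for k
  define Z where "Z k = (\<integral>\<^sup>+x. ennreal (norm (\<phi> k x - T x)) \<partial>?bd)" for k
  define V where "V = (\<integral>\<^sup>+x. ennreal (A (norm (v x))) \<partial>?\<Omega>)"
  define W where "W = (\<integral>\<^sup>+x. ennreal (A (norm (?G x))) \<partial>?\<Omega>)"
  have cont: "continuous_on UNIV (\<phi> k)" for k
    using smooth_vector_has_derivative_jacobian(1)[OF smooth]
    by (auto intro!: continuous_at_imp_continuous_on has_derivative_continuous)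
  have contB: "continuous_on UNIV (\<lambda>x. ?B (norm (c *\<^sub>R \<phi> k x)))" for k c
    by (intro continuous_on_compose2[OF continuous_on_primitive_norm[OF M0]] continuous_intros cont) auto
  have contb: "continuous_on UNIV (\<lambda>x. ?b (norm (\<phi> k x)) * norm (jacobian (\<phi> k) (at x)))" for k
    by (intro continuous_intros continuous_on_compose2[OF continuous_on_truncated_slope_norm[OF M0] cont]
        smooth_vector_has_derivative_jacobian(2)[OF smooth]) auto
  have measB_phi: "(\<lambda>x. ?B (norm (c *\<^sub>R \<phi> k x))) \<in> borel_measurable borel" for k c
    by (rule borel_measurable_continuous_onI[OF contB])
  have measB: "(\<lambda>x. ennreal (?B (c * norm (v x)))) \<in> borel_measurable ?\<Omega>" if "c \<ge> 0" for c
  proof -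
    have "(\<lambda>r::real. ?B (norm (c *\<^sub>R r))) \<in> borel_measurable borel"
      by (intro borel_measurable_continuous_onI continuous_on_compose2[OF continuous_on_primitive_norm[OF M0]]
          continuous_intros) auto
    from measurable_compose[OF v this] show ?thesis using that by (simp add: abs_mult)
  qed
  have measA: "(\<lambda>x. ennreal (A (norm (?G x)))) \<in> borel_measurable ?\<Omega>"
    using measurable_compose[OF G borel_measurable_continuous_onI[OF continuous_on_A_norm]] by simp
  \<comment> \<open>As \<open>?B\<close> is Lipschitz, it follows the approximation in mean, unlike \<open>A\<close>.\<close>
  have lip: "ennreal (?B (c * norm x)) \<le> ennreal (?B (c * norm y)) + ennreal (c * M) * ennreal (norm (x - y))"
    if "c > 0" for c and x y :: "real^'m"
  proof -
    have "?B (c * norm x) \<le> ?B (c * norm y) + M * \<bar>c * norm x - c * norm y\<bar>"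
      using that by (intro primitive_lipschitz[OF M0]) auto
    also have "\<bar>c * norm x - c * norm y\<bar> = c * \<bar>norm x - norm y\<bar>"
      using that by (simp add: abs_mult right_diff_distrib[symmetric])
    also have "M * (c * \<bar>norm x - norm y\<bar>) \<le> M * (c * norm (x - y))"
      using that M0 norm_triangle_ineq3[of x y] by (intro mult_left_mono) auto
    finally show ?thesis
      using that M0 by (simp add: ennreal_mult[symmetric] ennreal_plus[symmetric] primitive_nonneg mult_ac
          ennreal_leI del: ennreal_plus)
  qed
  have boundB_phi: "(\<integral>\<^sup>+x. ennreal (?B (c * norm (\<phi> k x))) \<partial>?\<Omega>)
      \<le> (\<integral>\<^sup>+x. ennreal (?B (c * norm (v x))) \<partial>?\<Omega>) + ennreal (c * M) * X k" if "c > 0" for c k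
    unfolding X_def using that M
    by (intro nn_integral_le_add_cmult measB lip) auto
  have BV1: "(\<integral>\<^sup>+x. ennreal (?B (norm (v x))) \<partial>?\<Omega>) \<le> V"
    unfolding V_def by (intro nn_integral_mono ennreal_leI primitive_le_A[OF M0]) simp
  have BV2: "(\<integral>\<^sup>+x. ennreal (?B (2 * norm (v x))) \<partial>?\<Omega>) \<le> ennreal \<kappa> * V"
  proof -
    have "(\<integral>\<^sup>+x. ennreal (?B (2 * norm (v x))) \<partial>?\<Omega>) \<le> (\<integral>\<^sup>+x. ennreal \<kappa> * ennreal (A (norm (v x))) \<partial>?\<Omega>)"
      using \<kappa> by (intro nn_integral_mono)
        (auto simp: ennreal_mult[symmetric] A_nonneg intro!: ennreal_leI order_trans[OF primitive_le_A[OF M0]])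
    also have "\<dots> = ennreal \<kappa> * V"
      unfolding V_def
      using measurable_compose[OF v borel_measurable_continuous_onI[OF continuous_on_A_norm]]
      by (intro nn_integral_cmult) simp
    finally show ?thesis .
  qed
  have grad: "(\<integral>\<^sup>+x. ennreal (?b (norm (\<phi> k x)) * norm (jacobian (\<phi> k) (at x))) \<partial>?\<Omega>)
      \<le> (W + (ennreal \<kappa> * V + ennreal (2 * M) * X k)) + ennreal M * Y k" for k
  proof -
    have "(\<integral>\<^sup>+x. ennreal (?b (norm (\<phi> k x)) * norm (jacobian (\<phi> k) (at x))) \<partial>?\<Omega>)
      \<le> (\<integral>\<^sup>+x. ennreal (A (norm (?G x))) + ennreal (?B (2 * norm (\<phi> k x))) \<partial>?\<Omega>) + ennreal M * Y k"
      unfolding Y_def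
    proof (rule nn_integral_le_add_cmult)
      have "(\<lambda>x. ?B (2 * norm (\<phi> k x))) \<in> borel_measurable ?\<Omega>"
        using measB_phi[of 2 k] by (intro measurable_restrict_space1 measurable_completion) simp
      then show "(\<lambda>x. ennreal (A (norm (?G x))) + ennreal (?B (2 * norm (\<phi> k x)))) \<in> borel_measurable ?\<Omega>"
        using measA by simp
      fix x
      let ?J = "jacobian (\<phi> k) (at x)"
      have "?b (norm (\<phi> k x)) * norm ?J
          \<le> ?b (norm (\<phi> k x)) * norm (?G x) + ?b (norm (\<phi> k x)) * norm (?J - ?G x)"
        using truncated_slope_bounds(1)[OF M0, of "norm (\<phi> k x)"] norm_triangle_sub[of ?J "?G x"]
        by (simp add: distrib_left[symmetric] mult_left_mono)
      also have "?b (norm (\<phi> k x)) * norm (?G x) \<le> A (norm (?G x)) + ?B (2 * norm (\<phi> k x))"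
        by (intro truncated_slope_young[OF M0]) auto
      also have "?b (norm (\<phi> k x)) * norm (?J - ?G x) \<le> M * norm (?J - ?G x)"
        by (intro mult_right_mono truncated_slope_bounds(2)[OF M0]) auto
      finally show "ennreal (?b (norm (\<phi> k x)) * norm ?J)
          \<le> ennreal (A (norm (?G x))) + ennreal (?B (2 * norm (\<phi> k x))) + ennreal M * ennreal (norm (?J - ?G x))"
        using M0 by (simp add: ennreal_mult[symmetric] ennreal_plus[symmetric] A_nonneg primitive_nonneg
            ennreal_leI del: ennreal_plus)
    qed (use M in auto)
    also have "(\<integral>\<^sup>+x. ennreal (A (norm (?G x))) + ennreal (?B (2 * norm (\<phi> k x))) \<partial>?\<Omega>)
        = W + (\<integral>\<^sup>+x. ennreal (?B (2 * norm (\<phi> k x))) \<partial>?\<Omega>)"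
      unfolding W_def
    proof (rule nn_integral_add[OF measA])
      have "(\<lambda>x. ?B (2 * norm (\<phi> k x))) \<in> borel_measurable ?\<Omega>"
        using measB_phi[of 2 k] by (intro measurable_restrict_space1 measurable_completion) simp
      then show "(\<lambda>x. ennreal (?B (2 * norm (\<phi> k x)))) \<in> borel_measurable ?\<Omega>" by simp
    qed
    also have "(\<integral>\<^sup>+x. ennreal (?B (2 * norm (\<phi> k x))) \<partial>?\<Omega>) \<le> ennreal \<kappa> * V + ennreal (2 * M) * X k"
      using boundB_phi[of 2 k] BV2 by (auto intro: order_trans add_right_mono)
    finally show ?thesis by (simp add: add_left_mono add_right_mono)
  qed
  have step: "(\<integral>\<^sup>+x. ennreal (?B (norm (T x))) \<partial>?bd)
      \<le> ennreal C * ((V + ennreal M * X k) + ((W + (ennreal \<kappa> * V + ennreal (2 * M) * X k)) + ennreal M * Y k))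
        + ennreal M * Z k" for k
  proof -
    have "(\<integral>\<^sup>+x. ennreal (?B (norm (T x))) \<partial>?bd)
        \<le> (\<integral>\<^sup>+x. ennreal (?B (norm (\<phi> k x))) \<partial>?bd) + ennreal M * Z k"
      unfolding Z_def
    proof (rule nn_integral_le_add_cmult)
      have "(\<lambda>x. ?B (norm (\<phi> k x))) \<in> borel_measurable ?bd"
        using borel_measurable_boundary_measure[OF measB_phi[of 1 k]] by simp
      then show "(\<lambda>x. ennreal (?B (norm (\<phi> k x)))) \<in> borel_measurable ?bd" by simp
      show "ennreal (?B (norm (T x))) \<le> ennreal (?B (norm (\<phi> k x))) + ennreal M * ennreal (norm (\<phi> k x - T x))"
        for x using lip[of 1 "T x" "\<phi> k x"] by (simp add: norm_minus_commute)
    qed (use M in auto)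
    also have "(\<integral>\<^sup>+x. ennreal (?B (norm (\<phi> k x))) \<partial>?bd)
        \<le> ennreal C * ((\<integral>\<^sup>+x. ennreal (?B (norm (\<phi> k x))) \<partial>?\<Omega>)
          + (\<integral>\<^sup>+x. ennreal (?b (norm (\<phi> k x)) * norm (jacobian (\<phi> k) (at x))) \<partial>?\<Omega>))"
      using measB_phi[of 1 k] borel_measurable_continuous_onI[OF contb[of k]]
      by (intro trace segment_gradient_bound_primitive M0 smooth) auto
    also have "\<dots> \<le> ennreal C * ((V + ennreal M * X k)
        + ((W + (ennreal \<kappa> * V + ennreal (2 * M) * X k)) + ennreal M * Y k))"
      using boundB_phi[of 1 k] BV1 grad[of k]
      by (intro mult_left_mono add_mono) (auto intro: order_trans add_right_mono)
    finally show ?thesis by (simp add: add_right_mono)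
  qed
  have "(\<lambda>k. ennreal C * ((V + ennreal M * X k) + ((W + (ennreal \<kappa> * V + ennreal (2 * M) * X k)) + ennreal M * Y k))
        + ennreal M * Z k)
      \<longlonglongrightarrow> ennreal C * ((V + ennreal M * 0) + ((W + (ennreal \<kappa> * V + ennreal (2 * M) * 0)) + ennreal M * 0))
        + ennreal M * 0"
    using X Y Z unfolding X_def Y_def Z_def
    by (intro tendsto_add ennreal_tendsto_cmult tendsto_const) auto
  then have "(\<integral>\<^sup>+x. ennreal (?B (norm (T x))) \<partial>?bd)
      \<le> ennreal C * ((V + ennreal M * 0) + ((W + (ennreal \<kappa> * V + ennreal (2 * M) * 0)) + ennreal M * 0))
        + ennreal M * 0"
    by (rule LIMSEQ_le_const) (use step in blast)
  also have "\<dots> = ennreal C * (W + (1 + ennreal \<kappa>) * V)"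
    by (simp add: distrib_left distrib_right ac_simps)
  also have "\<dots> \<le> ennreal C * ((1 + ennreal \<kappa>) * W + (1 + ennreal \<kappa>) * V)"
    by (intro mult_left_mono add_mono) (simp_all add: distrib_right)
  also have "\<dots> = ennreal (C * (1 + \<kappa>)) * (W + V)"
    using C \<kappa>(1) by (simp add: ennreal_mult distrib_left distrib_right mult_ac)
  finally show ?thesis by (simp add: V_def W_def)
qed

theorem proposition4p4:
  fixes \<Omega> :: "(real^'n) set" and A :: "real \<Rightarrow> real"
  assumes "CARD('n) \<ge> 2"
    and "bounded_lipschitz_domain \<Omega>"
    and "N_function A" and "Delta2 A"
  shows "\<exists>C_tr>0. \<forall>v \<in> (orlicz_sobolev_space A \<Omega> :: (real^'n \<Rightarrow> real^'n) set).
           \<forall>T. has_trace \<Omega> v T \<longrightarrow>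
             (\<integral>\<^sup>+ x. ennreal (A (norm (T x))) \<partial>boundary_measure \<Omega>)
               \<le> ennreal C_tr *
                  ((\<integral>\<^sup>+ x. ennreal (A (norm (weak_gradient \<Omega> v x))) \<partial>lebesgue_on \<Omega>)
                   + (\<integral>\<^sup>+ x. ennreal (A (norm (v x))) \<partial>lebesgue_on \<Omega>))"
proof -
  interpret N_function_locale A by unfold_locales fact
  obtain C where C: "C > 0" and trace:
    "\<And>u g. u \<in> borel_measurable borel \<Longrightarrow> g \<in> borel_measurable borel \<Longrightarrow> segment_gradient_bound u g \<Longrightarrow>
      (\<integral>\<^sup>+y. ennreal (u y) \<partial>boundary_measure \<Omega>)
        \<le> ennreal C * ((\<integral>\<^sup>+x. ennreal (u x) \<partial>lebesgue_on \<Omega>) + (\<integral>\<^sup>+x. ennreal (g x) \<partial>lebesgue_on \<Omega>))"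
    using trace_inequality_segment_gradient[OF assms(2)] by blast
  obtain \<kappa> where \<kappa>: "\<kappa> > 0" "\<And>s. s \<ge> 0 \<Longrightarrow> A (2 * s) \<le> \<kappa> * A s"
    using \<open>Delta2 A\<close> unfolding Delta2_def by blast
  show ?thesis
  proof (intro exI[of _ "\<kappa> * (C * (1 + \<kappa>))"] conjI ballI allI impI)
    show "0 < \<kappa> * (C * (1 + \<kappa>))" using C \<kappa>(1) by simp
    fix v T :: "real^'n \<Rightarrow> real^'n"
    assume v: "v \<in> orlicz_sobolev_space A \<Omega>" and T: "has_trace \<Omega> v T"
    define R where "R = (\<integral>\<^sup>+ x. ennreal (A (norm (weak_gradient \<Omega> v x))) \<partial>lebesgue_on \<Omega>)
                   + (\<integral>\<^sup>+ x. ennreal (A (norm (v x))) \<partial>lebesgue_on \<Omega>)"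
    let ?B = "\<lambda>n x. ennreal (truncated_primitive A (real (Suc n)) (norm (T x)))"
    have meas: "?B n \<in> borel_measurable (boundary_measure \<Omega>)" for n
    proof -
      have "T \<in> borel_measurable (boundary_measure \<Omega>)"
        using T by (auto simp: has_trace_def)
      from measurable_compose[OF this borel_measurable_continuous_onI[OF continuous_on_primitive_norm]]
      show ?thesis by simp
    qed
    have lim: "ennreal (A s) \<le> ennreal \<kappa> * (SUP n. ennreal (truncated_primitive A (real (Suc n)) s))"
      if "s \<ge> 0" for s
    proof -
      obtain n where n: "A (s / 2) / (s / 2) \<le> real n" using real_arch_simple by blast
      have "A s \<le> \<kappa> * A (s / 2)" using \<kappa>(2)[of "s / 2"] that by simp
      also have "\<dots> \<le> \<kappa> * truncated_primitive A (real (Suc n)) s"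
        using \<kappa>(1) n that by (intro mult_left_mono A_half_le_primitive) auto
      finally have "ennreal (A s) \<le> ennreal \<kappa> * ennreal (truncated_primitive A (real (Suc n)) s)"
        using \<kappa>(1) that primitive_nonneg[of "real (Suc n)" s] by (simp add: ennreal_mult[symmetric] ennreal_leI)
      also have "\<dots> \<le> ennreal \<kappa> * (SUP n. ennreal (truncated_primitive A (real (Suc n)) s))"
        by (intro mult_left_mono SUP_upper) auto
      finally show ?thesis .
    qed
    have "(\<integral>\<^sup>+ x. ennreal (A (norm (T x))) \<partial>boundary_measure \<Omega>)
        \<le> (\<integral>\<^sup>+ x. ennreal \<kappa> * (SUP n. ?B n x) \<partial>boundary_measure \<Omega>)"
      by (intro nn_integral_mono lim) simp
    also have "\<dots> = ennreal \<kappa> * (\<integral>\<^sup>+ x. (SUP n. ?B n x) \<partial>boundary_measure \<Omega>)"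
      using meas by (intro nn_integral_cmult borel_measurable_SUP) auto
    also have "(\<integral>\<^sup>+ x. (SUP n. ?B n x) \<partial>boundary_measure \<Omega>) = (SUP n. \<integral>\<^sup>+ x. ?B n x \<partial>boundary_measure \<Omega>)"
    proof (rule nn_integral_monotone_convergence_SUP[OF _ meas])
      show "incseq ?B"
        by (intro monoI le_funI ennreal_leI primitive_mono_level) auto
    qed
    also have "\<dots> \<le> ennreal (C * (1 + \<kappa>)) * R"
      unfolding R_def using v
      by (intro SUP_least trace_inequality_truncated C trace \<kappa> T)
         (auto simp: orlicz_sobolev_space_def orlicz_space_def)
    finally show "(\<integral>\<^sup>+ x. ennreal (A (norm (T x))) \<partial>boundary_measure \<Omega>) \<le> ennreal (\<kappa> * (C * (1 + \<kappa>))) * R"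
      using C \<kappa>(1) by (simp add: ennreal_mult mult.assoc mult_left_mono)
  qed
qed

end
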